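(* The map $\iota:Q^{\mathrm{dan}}\to Q^{\mathrm{oct}}$, $(\mathbf A,\mathbf b)\mapsto\left[\begin{pmatrix}1&\mathbf A\\ \mathbf b&-1\end{pmatrix}\right]$, is an embedding whose differential maps $\mathscr D^{\mathrm{dan}}$ onto $\mathscr D^{\mathrm{oct}}$ (restricted to the image), and the map $\Phi:S^2\times S^3\to\widetilde Q^{\mathrm{oct}}$, $$\Phi(\mathbf v,q)=\mathbb R^+\begin{pmatrix}\mathrm{Re}(\mathbf vq)&\mathbf v+\mathrm{Im}(\mathbf vq)\\ \mathbf v-\mathrm{Im}(\mathbf vq)&-\mathrm{Re}(\mathbf vq)\end{pmatrix},$$ is a diffeomorphism whose differential maps $\widetilde{\mathscr D}^{\mathrm{roll}}$ onto $\widetilde{\mathscr D}^{\mathrm{oct}}$.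
   Context: Split octonions $\mathbb O$: elements $\begin{pmatrix}x&\mathbf A\\ \mathbf b&y\end{pmatrix}$ with $x,y\in\mathbb R$, $\mathbf A\in\mathbb R^3$ (column), $\mathbf b\in(\mathbb R^3)^*$ (row), with product $\begin{pmatrix}x&\mathbf A\\ \mathbf b&y\end{pmatrix}\begin{pmatrix}x'&\mathbf A'\\ \mathbf b'&y'\end{pmatrix}=\begin{pmatrix}xx'-\mathbf b'\mathbf A& x\mathbf A'+y'\mathbf A+\mathbf b\times\mathbf b'\\ x'\mathbf b+y\mathbf b'+\mathbf A\times\mathbf A'& yy'-\mathbf b\mathbf A'\end{pmatrix}$, where $\mathbf A\times\mathbf A':=\det(\mathbf A,\mathbf A',\cdot)\in(\mathbb R^3)^*$ and $\mathbf b\times\mathbf b':=\det(\mathbf b,\mathbf b',\cdot)\in\mathbb R^3$. Quadratic form $\langle\zeta,\zeta\rangle=xy+\mathbf b\mathbf A$. $\mathrm{Im}(\mathbb O)$: elements with $y=-x$; $C\subset\mathrm{Im}(\mathbb O)$ the null cone $\{\langle\zeta,\zeta\rangle=0\}$. $Q^{\mathrm{oct}}:=(C\setminus0)/\mathbb R^*\subset\mathbb P(\mathrm{Im}\,\mathbb O)=\mathbb{RP}^6$; $\mathscr D^{\mathrm{oct}}$ at $[\zeta]$ is the tangent space at $[\zeta]$ of the projective plane $\mathbb P(\zeta^0)$, where $\zeta^0=\{\zeta'\in\mathrm{Im}(\mathbb O):\zeta\zeta'=0\}$ (a 3-dimensional subspace). $\widetilde Q^{\mathrm{oct}}:=(C\setminus0)/\mathbb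 R^+$ with $\widetilde{\mathscr D}^{\mathrm{oct}}$ the pullback of $\mathscr D^{\mathrm{oct}}$ under the double cover $\widetilde Q^{\mathrm{oct}}\to Q^{\mathrm{oct}}$. $Q^{\mathrm{dan}}:=\{(\mathbf A,\mathbf b)\in\mathbb R^3\times(\mathbb R^3)^*:\mathbf b\mathbf A=1\}$ with $\mathscr D^{\mathrm{dan}}$ consisting of tangent vectors with $\dot{\mathbf b}\mathbf A+\mathbf b\dot{\mathbf A}=0$, $\dot{\mathbf b}=\mathbf A\times\dot{\mathbf A}$. $Q^{\mathrm{roll}}=S^2\times\mathrm{SO}_3$ with $\mathscr D^{\mathrm{roll}}$ (radius ratio 3): vectors $(\dot{\mathbf v},\dot g)$ with $4\dot{\mathbf v}=\boldsymbol\omega\times\mathbf v$, $\boldsymbol\omega\cdot\mathbf v=0$, where $\dot gg^{-1}\mathbf x=\boldsymbol\omega\times\mathbf x$. $\widetilde Q^{\mathrm{roll}}=S^2\times S^3$ with $\widetilde{\mathscr D}^{\mathrm{roll}}$ the pullback of $\mathscr D^{\mathrm{roll}}$ under $(\mathbf v,q)\mapsto(\mathbf v,\mathbf x\mapsto q\mathbf x\bar q)$. In $\Phi$, $\mathbb R^3$ is identified with $\mathrm{Im}(\mathbb H)$ and with $(\mathbb R^3)^*$ via the Euclidean inner product. *)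

theory Defs
  imports "HOL-Analysis.Analysis" "HOL-Analysis.Cross3"
begin

fun Ck_on :: "nat \<Rightarrow> 'a::real_normed_vector set \<Rightarrow> ('a \<Rightarrow> 'b::real_normed_vector) \<Rightarrow> bool" where
  "Ck_on 0 U f = continuous_on U f"
| "Ck_on (Suc k) U f = (f differentiable_on U \<and>
      (\<forall>v. Ck_on k U (\<lambda>x. frechet_derivative f (at x) v)))"

definition smooth_on :: "'a::real_normed_vector set \<Rightarrow> ('a \<Rightarrow> 'b::real_normed_vector) \<Rightarrow> bool" where
  "smooth_on U f \<longleftrightarrow> (\<forall>k. Ck_on k U f)"

definition smooth_ext :: "'a::real_normed_vector set \<Rightarrow> ('a \<Rightarrow> 'b::real_normed_vector) \<Rightarrow> 'a set \<Rightarrow> ('a \<Rightarrow> 'b) \<Rightarrow> bool" where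
  "smooth_ext S f U F \<longleftrightarrow> open U \<and> S \<subseteq> U \<and> smooth_on U F \<and> (\<forall>x\<in>S. F x = f x)"

definition smooth_map_on :: "'a::real_normed_vector set \<Rightarrow> ('a \<Rightarrow> 'b::real_normed_vector) \<Rightarrow> bool" where
  "smooth_map_on S f \<longleftrightarrow> (\<exists>U F. smooth_ext S f U F)"

definition tangent_space :: "'a::real_normed_vector set \<Rightarrow> 'a \<Rightarrow> 'a set" where
  "tangent_space S p = {v. \<exists>\<gamma>::real \<Rightarrow> 'a. smooth_on UNIV \<gamma> \<and> (\<forall>t. \<gamma> t \<in> S) \<and> \<gamma> 0 = p \<and>
       (\<gamma> has_vector_derivative v) (at 0)}"

definition smooth_embedding :: "'a::real_normed_vector set \<Rightarrow> ('a \<Rightarrow> 'b::real_normed_vector) \<Rightarrow> bool" where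
  "smooth_embedding S f \<longleftrightarrow> inj_on f S \<and> (\<exists>g. homeomorphism S (f ` S) f g) \<and>
     (\<exists>U F. smooth_ext S f U F \<and>
        (\<forall>p\<in>S. inj_on (frechet_derivative F (at p)) (tangent_space S p)))"

definition diffeomorphism :: "'a::real_normed_vector set \<Rightarrow> 'b::real_normed_vector set \<Rightarrow> ('a \<Rightarrow> 'b) \<Rightarrow> bool" where
  "diffeomorphism S T f \<longleftrightarrow> bij_betw f S T \<and> smooth_map_on S f \<and> smooth_map_on T (inv_into S f)"

text \<open>The differential of f (on S) maps the distribution D onto the distribution D' along f:
  for a smooth extension F of f, dF_p (D p) = D' p for every p in S.
  (D p is always a set of tangent vectors of S at p, so this does not depend on F.)\<close>
definition differential_maps_onto ::
  "'a::real_normed_vector set \<Rightarrow> ('a \<Rightarrow> 'b::real_normed_vector) \<Rightarrow> ('a \<Rightarrow> 'a set) \<Rightarrow> ('a \<Rightarrow> 'b set) \<Rightarrow> bool" where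
  "differential_maps_onto S f D D' \<longleftrightarrow>
     (\<exists>U F. smooth_ext S f U F \<and> (\<forall>p\<in>S. frechet_derivative F (at p) ` D p = D' p))"

text \<open>(x, A, b, y) stands for the matrix ((x, A), (b, y)); the row vector b is stored by its
  coordinates in real^3.  b A is the pairing, A \<times> A' = det(A,A',.) is the cross product.\<close>
type_synonym oct = "real \<times> (real^3) \<times> (real^3) \<times> real"

fun oct_mult :: "oct \<Rightarrow> oct \<Rightarrow> oct" where
  "oct_mult (x, A, b, y) (x', A', b', y') =
     (x * x' - b' \<bullet> A,
      x *\<^sub>R A' + y' *\<^sub>R A + cross3 b b',
      x' *\<^sub>R b + y *\<^sub>R b' + cross3 A A',
      y * y' - b \<bullet> A')"

fun oct_form :: "oct \<Rightarrow> real" where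
  "oct_form (x, A, b, y) = x * y + b \<bullet> A"

definition Im_oct :: "oct set" where
  "Im_oct = {(x, A, b, y). y = - x}"

definition null_cone :: "oct set" where
  "null_cone = {\<zeta> \<in> Im_oct. oct_form \<zeta> = 0}"

definition annih :: "oct \<Rightarrow> oct set" where
  "annih \<zeta> = {\<zeta>' \<in> Im_oct. oct_mult \<zeta> \<zeta>' = 0}"

text \<open>Model of the projective space P(Im O): the (Veronese) embedding of lines as orthogonal
  projections, [w] \<mapsto> w w^T / |w|^2.  Q^oct is modelled as ver ` (C - {0}).\<close>
definition ver :: "oct \<Rightarrow> (oct \<Rightarrow>\<^sub>L oct)" where
  "ver w = Blinfun (\<lambda>u. ((w \<bullet> u) / (w \<bullet> w)) *\<^sub>R w)"

definition Q_oct :: "(oct \<Rightarrow>\<^sub>L oct) set" where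
  "Q_oct = ver ` (null_cone - {0})"

definition D_oct :: "oct \<Rightarrow> (oct \<Rightarrow>\<^sub>L oct) set" where
  "D_oct \<zeta> = tangent_space (ver ` (annih \<zeta> - {0})) (ver \<zeta>)"

text \<open>Model of the ray space (C - 0)/R^+ : rays represented by unit (Euclidean) vectors.\<close>
definition sph :: "oct \<Rightarrow> oct" where
  "sph w = (1 / norm w) *\<^sub>R w"

definition Qt_oct :: "oct set" where
  "Qt_oct = sph ` (null_cone - {0})"

text \<open>Pullback of D^oct to the double cover: tangent space of the preimage of P(\<zeta>^0).\<close>
definition Dt_oct :: "oct \<Rightarrow> oct set" where
  "Dt_oct \<zeta> = tangent_space (sph ` (annih \<zeta> - {0})) (sph \<zeta>)"

definition Q_dan :: "((real^3) \<times> (real^3)) set" where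
  "Q_dan = {(A, b). b \<bullet> A = 1}"

definition D_dan :: "(real^3) \<times> (real^3) \<Rightarrow> ((real^3) \<times> (real^3)) set" where
  "D_dan p = {(dA, db) \<in> tangent_space Q_dan p.
      db \<bullet> fst p + snd p \<bullet> dA = 0 \<and> db = cross3 (fst p) dA}"

definition iota_lift :: "(real^3) \<times> (real^3) \<Rightarrow> oct" where
  "iota_lift p = (1, fst p, snd p, -1)"

definition iota :: "(real^3) \<times> (real^3) \<Rightarrow> (oct \<Rightarrow>\<^sub>L oct)" where
  "iota p = ver (iota_lift p)"

text \<open>Quaternions as (real part, imaginary part in real^3 = Im H).\<close>
type_synonym quat = "real \<times> (real^3)"

fun qmult :: "quat \<Rightarrow> quat \<Rightarrow> quat" where
  "qmult (a, u) (b, w) = (a * b - u \<bullet> w, a *\<^sub>R w + b *\<^sub>R u + cross3 u w)"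

fun qconj :: "quat \<Rightarrow> quat" where
  "qconj (a, u) = (a, - u)"

definition S2 :: "(real^3) set" where "S2 = sphere 0 1"
definition S3 :: "quat set" where "S3 = sphere 0 1"

definition SO3 :: "(real^3^3) set" where
  "SO3 = {g. orthogonal_matrix g \<and> det g = 1}"

definition Q_roll :: "((real^3) \<times> (real^3^3)) set" where
  "Q_roll = S2 \<times> SO3"

definition D_roll :: "(real^3) \<times> (real^3^3) \<Rightarrow> ((real^3) \<times> (real^3^3)) set" where
  "D_roll p = {(dv, dg) \<in> tangent_space Q_roll p.
      \<exists>\<omega>. (\<forall>x. (dg ** matrix_inv (snd p)) *v x = cross3 \<omega> x) \<and>
          4 *\<^sub>R dv = cross3 \<omega> (fst p) \<and> \<omega> \<bullet> fst p = 0}"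

definition rot :: "quat \<Rightarrow> real^3^3" where
  "rot q = matrix (\<lambda>x. snd (qmult (qmult q (0, x)) (qconj q)))"

definition cover_roll :: "(real^3) \<times> quat \<Rightarrow> (real^3) \<times> (real^3^3)" where
  "cover_roll p = (fst p, rot (snd p))"

definition Qt_roll :: "((real^3) \<times> quat) set" where
  "Qt_roll = S2 \<times> S3"

definition Dt_roll :: "(real^3) \<times> quat \<Rightarrow> ((real^3) \<times> quat) set" where
  "Dt_roll p = {w \<in> tangent_space Qt_roll p.
      frechet_derivative cover_roll (at p) w \<in> D_roll (cover_roll p)}"

definition Phi_lift :: "(real^3) \<times> quat \<Rightarrow> oct" where
  "Phi_lift p = (let v = fst p; r = qmult (0, v) (snd p) in
     (fst r, v + snd r, v - snd r, - fst r))"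

definition Phi :: "(real^3) \<times> quat \<Rightarrow> oct" where
  "Phi p = sph (Phi_lift p)"

end

theory Submission
  imports Defs
begin

text \<open>
  If \<open>P\<close> is a smooth curve of projections onto lines of \<open>\<zeta>\<^sup>0\<close> with \<open>P 0 = [\<zeta>]\<close>, then \<open>P t \<zeta>\<close>
  is a lift to the vector space \<open>\<zeta>\<^sup>0\<close>; hence the distribution at \<open>[\<zeta>]\<close> is the image of \<open>\<zeta>\<^sup>0\<close> under
  the derivative of \<open>w \<mapsto> [w]\<close>. Modulo \<open>\<zeta> = (1, A, b, -1)\<close>, the equation \<open>\<zeta>\<zeta>' = 0\<close> reads
  \<open>\<zeta>' = (0, A', A \<times> A', 0)\<close> with \<open>b A' = 0\<close>, which is the dancing distribution.

  An imaginary split octonion is a pair of \<open>a\<close> in \<open>Im H\<close> and a quaternion \<open>r\<close>, namely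
  \<open>(Re r, a + Im r, a - Im r, - Re r)\<close>, with quadratic form \<open>|a|\<^sup>2 - |r|\<^sup>2\<close>. So the unit null vectors
  are, up to the factor 2, the pairs of a unit \<open>v\<close> and a unit \<open>r = vq\<close>, and \<open>\<Phi>\<close> is the restriction
  of a polynomial map with polynomial inverse. The orthogonal complement of \<open>(v, r)\<close> in its
  annihilator consists of the \<open>(a, (a \<times> v) r)\<close> with \<open>a\<close> orthogonal to \<open>v\<close>. For a rolling velocity the
  angular velocity is \<open>\<omega> = 4 v \<times> v'\<close>, so \<open>q' = \<omega> q / 2 = 2 v v' q\<close> and \<open>(vq)' = - v' q = (v' \<times> v) r\<close>.
\<close>

section \<open>Calculus of smooth functions\<close>

text \<open>On an open set the derivative at a point depends only on nearby values, so agreement on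
  \<open>U\<close> passes to all directional derivatives. This permits replacing
  \<open>frechet_derivative\<close> by a formula valid only on \<open>U\<close>.\<close>

lemma Ck_on_cong:
  assumes "open U" "\<And>x. x \<in> U \<Longrightarrow> f x = g x"
  shows "Ck_on k U f = Ck_on k U g"
  using assms(2)
proof (induction k arbitrary: f g)
  case 0
  then show ?case by (simp cong: continuous_on_cong)
next
  case (Suc k)
  have *: "(f has_derivative D) (at x) \<longleftrightarrow> (g has_derivative D) (at x)" if "x \<in> U" for x D
    using Suc.prems assms(1) that has_derivative_transform_within_open[of f D x UNIV U g]
      has_derivative_transform_within_open[of g D x UNIV U f] by auto
  have "frechet_derivative f (at x) = frechet_derivative g (at x)" if "x \<in> U" for x
    unfolding frechet_derivative_def using *[OF that] by simp
  moreover have "f differentiable_on U \<longleftrightarrow> g differentiable_on U"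
    using * by (simp add: differentiable_on_def differentiable_def at_within_open[OF _ assms(1)])
  ultimately show ?case
    using Suc.IH[of "\<lambda>x. frechet_derivative f (at x) v" "\<lambda>x. frechet_derivative g (at x) v" for v]
    unfolding Ck_on.simps by metis
qed

text \<open>Trades the derivative chosen by \<open>frechet_derivative\<close> for an explicit
  \<open>f'\<close>; the closure rules below raise the order of differentiability through
  it.\<close>

lemma Ck_on_SucI:
  assumes "open U" "\<And>x. x \<in> U \<Longrightarrow> (f has_derivative f' x) (at x)"
    and "\<And>v. Ck_on k U (\<lambda>x. f' x v)"
  shows "Ck_on (Suc k) U f"
proof -
  have "Ck_on k U (\<lambda>x. frechet_derivative f (at x) v)" for v
    using Ck_on_cong[OF assms(1), of "\<lambda>x. frechet_derivative f (at x) v" "\<lambda>x. f' x v" k]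
      assms(3) frechet_derivative_at[OF assms(2)] by metis
  moreover have "f differentiable_on U"
    using assms(2) unfolding differentiable_on_def differentiable_def
    by (metis at_within_open assms(1))
  ultimately show ?thesis by simp
qed

lemma Ck_on_SucD:
  assumes "Ck_on (Suc k) U f" "open U" "x \<in> U"
  shows "(f has_derivative frechet_derivative f (at x)) (at x)"
  using assms by (simp add: differentiable_on_def at_within_open[OF _ assms(2)] frechet_derivative_works)

text \<open>Needed for products and reciprocals, whose derivatives still contain undifferentiated
  factors.\<close>

lemma Ck_on_Suc_imp:
  assumes "Ck_on (Suc k) U f"
  shows "Ck_on k U f"
  using assms
proof (induction k arbitrary: f)
  case 0
  then show ?case by (simp add: differentiable_imp_continuous_on)
next
  case (Suc k)
  then show ?case by (metis Ck_on.simps(2))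
qed

lemma Ck_on_const: "open U \<Longrightarrow> Ck_on k U (\<lambda>x. c)"
proof (induction k arbitrary: c)
  case (Suc k)
  show ?case
    by (rule Ck_on_SucI[where f' = "\<lambda>_ _. 0"]) (use Suc in simp_all)
qed simp

lemma Ck_on_add:
  assumes "open U" "Ck_on k U f" "Ck_on k U g"
  shows "Ck_on k U (\<lambda>x. f x + g x)"
  using assms(2,3)
proof (induction k arbitrary: f g)
  case (Suc k)
  show ?case
  proof (rule Ck_on_SucI[OF assms(1), where f' =
        "\<lambda>x v. frechet_derivative f (at x) v + frechet_derivative g (at x) v"])
    fix v
    show "Ck_on k U (\<lambda>x. frechet_derivative f (at x) v + frechet_derivative g (at x) v)"
      by (rule Suc.IH) (use Suc.prems in simp_all)
  qed (use Suc.prems assms(1) in \<open>intro has_derivative_add Ck_on_SucD\<close>)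
qed (simp add: continuous_on_add)

lemma Ck_on_bounded_linear:
  assumes "bounded_linear L" "open U" "Ck_on k U f"
  shows "Ck_on k U (\<lambda>x. L (f x))"
  using assms(3)
proof (induction k arbitrary: f)
  case 0
  then show ?case using assms(1) bounded_linear.continuous_on by auto
next
  case (Suc k)
  show ?case
  proof (rule Ck_on_SucI[OF assms(2), where f' = "\<lambda>x v. L (frechet_derivative f (at x) v)"])
    fix v
    show "Ck_on k U (\<lambda>x. L (frechet_derivative f (at x) v))"
      by (rule Suc.IH) (use Suc.prems in simp)
  qed (use Suc.prems assms(2) in \<open>intro bounded_linear.has_derivative[OF assms(1)] Ck_on_SucD\<close>)
qed

text \<open>Both terms of the product rule have again the form \<open>B (f x) (g x)\<close>, with
  one factor differentiated, so the induction must leave \<open>f\<close> and \<open>g\<close>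
  arbitrary.\<close>

lemma Ck_on_bounded_bilinear:
  assumes "bounded_bilinear B" "open U" "Ck_on k U f" "Ck_on k U g"
  shows "Ck_on k U (\<lambda>x. B (f x) (g x))"
  using assms(3,4)
proof (induction k arbitrary: f g)
  case 0
  then show ?case using assms(1) bounded_bilinear.continuous_on by auto
next
  case (Suc k)
  show ?case
  proof (rule Ck_on_SucI[OF assms(2), where f' = "\<lambda>x v. B (f x) (frechet_derivative g (at x) v) +
        B (frechet_derivative f (at x) v) (g x)"])
    fix v
    show "Ck_on k U (\<lambda>x. B (f x) (frechet_derivative g (at x) v) + B (frechet_derivative f (at x) v) (g x))"
      by (intro Ck_on_add Suc.IH assms) (use Suc.prems Ck_on_Suc_imp in auto)
  qed (use Suc.prems assms(2) in \<open>intro bounded_bilinear.FDERIV[OF assms(1)] Ck_on_SucD\<close>)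
qed

lemma Ck_on_inverse:
  fixes f :: "'a::real_normed_vector \<Rightarrow> real"
  assumes "open U" "Ck_on k U f" "\<And>x. x \<in> U \<Longrightarrow> f x \<noteq> 0"
  shows "Ck_on k U (\<lambda>x. inverse (f x))"
  using assms(2)
proof (induction k)
  case 0
  then show ?case using assms(3) by (simp add: continuous_on_inverse)
next
  case (Suc k)
  have IH: "Ck_on k U (\<lambda>x. inverse (f x))"
    using Suc Ck_on_Suc_imp by blast
  show ?case
  \<comment> \<open>The derivative of a reciprocal is a product involving the reciprocal itself,
    whose lower-order smoothness is the induction hypothesis.\<close>
  proof (rule Ck_on_SucI[OF assms(1), where f' =
        "\<lambda>x v. - (inverse (f x) * frechet_derivative f (at x) v * inverse (f x))"])
    fix v
    show "Ck_on k U (\<lambda>x. - (inverse (f x) * frechet_derivative f (at x) v * inverse (f x)))"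
      by (intro Ck_on_bounded_linear[OF bounded_linear_minus[OF bounded_linear_ident]]
            Ck_on_bounded_bilinear[OF bounded_bilinear_mult] IH assms)
         (use Suc.prems in auto)
  next
    fix x assume "x \<in> U"
    then show "((\<lambda>x. inverse (f x)) has_derivative
        (\<lambda>v. - (inverse (f x) * frechet_derivative f (at x) v * inverse (f x)))) (at x)"
      using Deriv.has_derivative_inverse[OF assms(3) Ck_on_SucD[OF Suc.prems assms(1)]] by blast
  qed
qed

lemma Ck_on_ident: "open U \<Longrightarrow> Ck_on k U (\<lambda>x. x)"
proof (cases k)
  case (Suc m)
  then show "Ck_on k U (\<lambda>x. x)" if "open U"
    using Ck_on_SucI[OF that has_derivative_ident] Ck_on_const[OF that] by blast
qed simp

section \<open>Closure rules for smooth maps\<close>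

named_theorems smooth_intros

lemma smooth_on_const [smooth_intros]: "open U \<Longrightarrow> smooth_on U (\<lambda>x. c)"
  and smooth_on_ident [smooth_intros]: "open U \<Longrightarrow> smooth_on U (\<lambda>x. x)"
  by (simp_all add: smooth_on_def Ck_on_const Ck_on_ident)

lemma smooth_on_add [smooth_intros]:
  "open U \<Longrightarrow> smooth_on U f \<Longrightarrow> smooth_on U g \<Longrightarrow> smooth_on U (\<lambda>x. f x + g x)"
  using Ck_on_add[of U _ f g] unfolding smooth_on_def by blast

lemma smooth_on_bounded_linear:
  "bounded_linear L \<Longrightarrow> open U \<Longrightarrow> smooth_on U f \<Longrightarrow> smooth_on U (\<lambda>x. L (f x))"
  using Ck_on_bounded_linear[of L U _ f] unfolding smooth_on_def by blast

lemma smooth_on_bounded_bilinear: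
  "bounded_bilinear B \<Longrightarrow> open U \<Longrightarrow> smooth_on U f \<Longrightarrow> smooth_on U g \<Longrightarrow>
    smooth_on U (\<lambda>x. B (f x) (g x))"
  using Ck_on_bounded_bilinear[of B U _ f g] unfolding smooth_on_def by blast

lemma smooth_on_inverse [smooth_intros]:
  fixes f :: "'a::real_normed_vector \<Rightarrow> real"
  shows "open U \<Longrightarrow> smooth_on U f \<Longrightarrow> (\<And>x. x \<in> U \<Longrightarrow> f x \<noteq> 0) \<Longrightarrow> smooth_on U (\<lambda>x. inverse (f x))"
  using Ck_on_inverse[of U _ f] unfolding smooth_on_def by blast

lemmas [smooth_intros] =
  smooth_on_bounded_linear[OF bounded_linear_fst]
  smooth_on_bounded_linear[OF bounded_linear_snd]
  smooth_on_bounded_linear[OF bounded_linear_minus[OF bounded_linear_ident]]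
  smooth_on_bounded_bilinear[OF bounded_bilinear_mult]
  smooth_on_bounded_bilinear[OF bounded_bilinear_scaleR]
  smooth_on_bounded_bilinear[OF bounded_bilinear_inner]

lemma smooth_on_diff [smooth_intros]:
  "open U \<Longrightarrow> smooth_on U f \<Longrightarrow> smooth_on U g \<Longrightarrow> smooth_on U (\<lambda>x. f x - g x)"
  using smooth_on_add[of U f "\<lambda>x. - g x"]
    smooth_on_bounded_linear[OF bounded_linear_minus[OF bounded_linear_ident], of U g] by simp

lemma smooth_on_Pair [smooth_intros]:
  assumes "open U" "smooth_on U f" "smooth_on U g"
  shows "smooth_on U (\<lambda>x. (f x, g x))"
proof -
  have "smooth_on U (\<lambda>x. (f x, 0) + (0, g x))"
    by (intro smooth_intros assms smooth_on_bounded_linear[of "\<lambda>u. (u, 0)"]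
          smooth_on_bounded_linear[of "\<lambda>u. (0, u)"] bounded_linear_Pair
          bounded_linear_ident bounded_linear_zero)
  then show ?thesis by simp
qed

section \<open>Tangent vectors\<close>

lemma smooth_extI_UNIV:
  "smooth_on UNIV F \<Longrightarrow> (\<And>x. x \<in> S \<Longrightarrow> F x = f x) \<Longrightarrow> smooth_ext S f UNIV F"
  by (simp add: smooth_ext_def)

lemma tangent_spaceI:
  assumes "smooth_on UNIV \<gamma>" "\<And>t. \<gamma> t \<in> S" "\<gamma> 0 = p" "(\<gamma> has_vector_derivative v) (at 0)"
  shows "v \<in> tangent_space S p"
  using assms unfolding tangent_space_def by blast

lemma tangent_spaceE:
  assumes "v \<in> tangent_space S p"
  obtains \<gamma> where "smooth_on UNIV \<gamma>" "\<And>t. \<gamma> t \<in> S" "\<gamma> 0 = p" "(\<gamma> has_vector_derivative v) (at 0)"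
  using assms unfolding tangent_space_def by blast

text \<open>Stereographic parametrisation of the great circle through \<open>e\<close> in direction \<open>h\<close>; being rational,
  it is smooth without any square root or trigonometric function.\<close>
definition circ :: "'a::real_inner \<Rightarrow> 'a \<Rightarrow> real \<Rightarrow> 'a" where
  "circ e h t = inverse (1 + (h \<bullet> h) / 4 * (t * t)) *\<^sub>R ((1 - (h \<bullet> h) / 4 * (t * t)) *\<^sub>R e + t *\<^sub>R h)"

lemma circ_denominator_pos: "0 < 1 + (h \<bullet> h) / 4 * (t * t)"
  by (simp add: add_pos_nonneg)

lemma smooth_on_circ: "smooth_on UNIV (circ e h)"
  unfolding circ_def
  by (intro smooth_intros open_UNIV) (rule circ_denominator_pos[THEN less_imp_neq, THEN not_sym])

lemma circ_0 [simp]: "circ e h 0 = e"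
  by (simp add: circ_def)

lemma circ_has_vector_derivative: "(circ e h has_vector_derivative h) (at 0)"
proof -
  \<comment> \<open>The parameter enters the denominator only through its square, so to first order
    at 0 only the term \<open>t *\<^sub>R h\<close> moves.\<close>
  have "((\<lambda>t. inverse (1 + (h \<bullet> h) / 4 * (t * t))) has_derivative (\<lambda>t. 0)) (at 0)"
    "((\<lambda>t. (1 - (h \<bullet> h) / 4 * (t * t)) *\<^sub>R e + t *\<^sub>R h) has_derivative (\<lambda>t. t *\<^sub>R h)) (at 0)"
    by (rule derivative_eq_intros refl | simp)+
  from has_derivative_scaleR[OF this] show ?thesis
    by (simp add: circ_def[abs_def] has_vector_derivative_def)
qed

text \<open>With \<open>c = |h|^2 t^2 / 4\<close> this is Pythagoras and
  \<open>(1 - c)^2 + 4 c = (1 + c)^2\<close>. There is no division by the length of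
  \<open>h\<close>, so the zero velocity needs no separate case.\<close>

lemma norm_circ:
  assumes "norm e = 1" "h \<bullet> e = 0"
  shows "norm (circ e h t) = 1"
proof -
  define c where "c = (h \<bullet> h) / 4 * (t * t)"
  have e: "e \<bullet> e = 1" using assms(1) by (simp add: norm_eq_1)
  have "((1 - c) *\<^sub>R e + t *\<^sub>R h) \<bullet> ((1 - c) *\<^sub>R e + t *\<^sub>R h) = (1 - c)\<^sup>2 + 4 * c"
    using assms(2) e
    by (simp add: inner_add_left inner_add_right inner_commute[of e h] power2_eq_square c_def)
  also have "\<dots> = (1 + c)\<^sup>2"
    by (simp add: power2_eq_square algebra_simps)
  finally have "norm ((1 - c) *\<^sub>R e + t *\<^sub>R h) = 1 + c"
    using circ_denominator_pos[of h t] by (simp add: norm_eq_sqrt_inner c_def)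
  then show ?thesis
    using circ_denominator_pos[of h t] unfolding circ_def c_def[symmetric] by simp
qed

lemma has_vector_derivative_kernel:
  assumes "bounded_linear N" "\<And>t. N (\<gamma> t) = 0" "(\<gamma> has_vector_derivative v) (at t)"
  shows "N v = 0"
proof -
  have "((\<lambda>t. N (\<gamma> t)) has_vector_derivative N v) (at t)"
    using assms bounded_linear.has_vector_derivative by blast
  then have "((\<lambda>t. 0) has_vector_derivative N v) (at t)"
    by (simp add: assms(2))
  then show ?thesis
    using vector_derivative_unique_at has_vector_derivative_const by blast
qed

lemma has_vector_derivative_sphere:
  fixes \<gamma> :: "real \<Rightarrow> 'a::real_inner"
  assumes "\<And>t. norm (\<gamma> t) = 1" "(\<gamma> has_vector_derivative v) (at t)"
  shows "v \<bullet> \<gamma> t = 0"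
proof -
  have "((\<lambda>t. \<gamma> t \<bullet> \<gamma> t) has_vector_derivative \<gamma> t \<bullet> v + v \<bullet> \<gamma> t) (at t)"
    by (rule bounded_bilinear.has_vector_derivative[OF bounded_bilinear_inner assms(2) assms(2)])
  moreover have "(\<lambda>t. \<gamma> t \<bullet> \<gamma> t) = (\<lambda>t. 1)"
    using assms(1) by (simp add: norm_eq_1)
  ultimately have "\<gamma> t \<bullet> v + v \<bullet> \<gamma> t = 0"
    using vector_derivative_unique_at has_vector_derivative_const by metis
  then show ?thesis by (simp add: inner_commute)
qed

section \<open>The distribution on projectivised null vectors\<close>

definition outer :: "'a::real_inner \<Rightarrow> 'b::real_normed_vector \<Rightarrow> ('a \<Rightarrow>\<^sub>L 'b)" where
  "outer u w = blinfun_compose (blinfun_scaleR_left w) (blinfun_inner_right u)"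

lemma outer_apply [simp]: "blinfun_apply (outer u w) x = (u \<bullet> x) *\<^sub>R w"
  by (simp add: outer_def)

text \<open>Bilinearity of the rank-one operator opens \<open>ver\<close> to the smoothness rules
  and to the product rule.\<close>

lemma bounded_bilinear_outer: "bounded_bilinear outer"
proof -
  have "bounded_bilinear (\<lambda>w u. blinfun_compose (blinfun_scaleR_left w) (blinfun_inner_right u))"
    by (rule bounded_bilinear.comp[OF bounded_bilinear_blinfun_compose
          bounded_linear_blinfun_scaleR_left bounded_linear_blinfun_inner_right])
  from bounded_bilinear.flip[OF this] show ?thesis
    by (simp add: outer_def[abs_def])
qed

lemmas [smooth_intros] = smooth_on_bounded_bilinear[OF bounded_bilinear_outer]

text \<open>Exhibits the function under \<open>Blinfun\<close> as a bounded operator, so that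
  \<open>ver\<close> can be evaluated. At \<open>w = 0\<close> both sides vanish because division by
  zero yields zero.\<close>

lemma ver_eq: "ver w = inverse (w \<bullet> w) *\<^sub>R outer w w"
proof -
  have "(\<lambda>u. ((w \<bullet> u) / (w \<bullet> w)) *\<^sub>R w) = blinfun_apply (inverse (w \<bullet> w) *\<^sub>R outer w w)"
    by (auto simp: fun_eq_iff scaleR_blinfun.rep_eq divide_inverse mult.commute)
  then show ?thesis
    unfolding ver_def by (simp add: blinfun_apply_inverse)
qed

lemma ver_apply: "blinfun_apply (ver w) u = ((w \<bullet> u) / (w \<bullet> w)) *\<^sub>R w"
  by (simp add: ver_eq scaleR_blinfun.rep_eq divide_inverse mult.commute)

lemma ver_scaleR: "c \<noteq> 0 \<Longrightarrow> ver (c *\<^sub>R w) = ver w"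
  by (rule blinfun_eqI) (simp add: ver_apply)

text \<open>The quotient rule for \<open>w w^T / |w|^2\<close>: the differential of
  \<open>ver\<close> at a nonzero \<open>w\<close> in direction \<open>h\<close>.\<close>

definition dver :: "oct \<Rightarrow> oct \<Rightarrow> (oct \<Rightarrow>\<^sub>L oct)" where
  "dver w h = inverse (w \<bullet> w) *\<^sub>R (outer w h + outer h w)
     - (2 * (w \<bullet> h) * inverse (w \<bullet> w) * inverse (w \<bullet> w)) *\<^sub>R outer w w"

lemma has_derivative_ver:
  assumes "w \<noteq> 0"
  shows "(ver has_derivative dver w) (at w)"
proof -
  have "((\<lambda>w::oct. inverse (w \<bullet> w)) has_derivative
      (\<lambda>h. - (inverse (w \<bullet> w) * (w \<bullet> h + h \<bullet> w) * inverse (w \<bullet> w)))) (at w)"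
    by (rule Deriv.has_derivative_inverse)
      (use assms in \<open>auto intro!: derivative_eq_intros\<close>)
  moreover have "((\<lambda>w::oct. outer w w) has_derivative (\<lambda>h. outer w h + outer h w)) (at w)"
    by (rule bounded_bilinear.FDERIV[OF bounded_bilinear_outer has_derivative_ident has_derivative_ident])
  ultimately show ?thesis
    unfolding ver_eq[abs_def]
    by (rule has_derivative_eq_rhs[OF has_derivative_scaleR])
      (simp add: fun_eq_iff dver_def inner_commute algebra_simps)
qed

lemma bounded_linear_dver: "w \<noteq> 0 \<Longrightarrow> bounded_linear (dver w)"
  by (rule has_derivative_bounded_linear[OF has_derivative_ver])

text \<open>Reflects that \<open>ver\<close> is constant along the line through
  \<open>w\<close>.\<close>

lemma dver_self: "w \<noteq> 0 \<Longrightarrow> dver w w = 0"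
  by (rule blinfun_eqI)
    (simp add: dver_def minus_blinfun.rep_eq plus_blinfun.rep_eq scaleR_blinfun.rep_eq
      flip: scaleR_left_distrib)

text \<open>Only the radial direction is lost: the operator \<open>dver w h\<close>, applied to
  \<open>w\<close>, returns the component of \<open>h\<close> orthogonal to
  \<open>w\<close>.\<close>

lemma dver_eq_0:
  assumes "w \<noteq> 0" "dver w h = 0"
  shows "h = ((w \<bullet> h) / (w \<bullet> w)) *\<^sub>R w"
proof -
  have "blinfun_apply (dver w h) w = h - ((w \<bullet> h) / (w \<bullet> w)) *\<^sub>R w"
    using assms(1)
    by (simp add: dver_def minus_blinfun.rep_eq plus_blinfun.rep_eq scaleR_blinfun.rep_eq
      scaleR_right_distrib divide_inverse inner_commute[of h w])
      (simp add: algebra_simps flip: scaleR_left_distrib)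
  then show ?thesis using assms(2) by simp
qed

section \<open>Annihilators as linear subspaces\<close>

lemma bounded_linear_oct_mult: "bounded_linear (oct_mult \<zeta>)"
proof -
  obtain x A b y where \<zeta>: "\<zeta> = (x, A, b, y)" by (cases \<zeta>)
  have "oct_mult \<zeta> = (\<lambda>\<eta>. (x * fst \<eta> - fst (snd (snd \<eta>)) \<bullet> A,
      x *\<^sub>R fst (snd \<eta>) + snd (snd (snd \<eta>)) *\<^sub>R A + cross3 b (fst (snd (snd \<eta>))),
      fst \<eta> *\<^sub>R b + y *\<^sub>R fst (snd (snd \<eta>)) + cross3 A (fst (snd \<eta>)),
      y * snd (snd (snd \<eta>)) - b \<bullet> fst (snd \<eta>)))"
    by (auto simp: \<zeta>)
  moreover have "linear \<dots>"
    by (rule linearI) (simp_all add: cross_add_right cross_mult_right algebra_simps)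
  ultimately show ?thesis by (simp add: linear_conv_bounded_linear)
qed

lemma linear_oct_mult: "linear (oct_mult \<zeta>)"
  by (rule bounded_linear.linear[OF bounded_linear_oct_mult])

text \<open>\<open>annih \<zeta>\<close> is cut out by linear equations, vanishing product and
  vanishing trace, and these pass to velocities.\<close>

lemma annih_derivative:
  assumes "\<And>t. \<gamma> t \<in> annih \<zeta>" "(\<gamma> has_vector_derivative v) (at t)"
  shows "v \<in> annih \<zeta>"
proof -
  have "oct_mult \<zeta> v = 0"
    by (rule has_vector_derivative_kernel[OF bounded_linear_oct_mult _ assms(2)])
      (use assms(1) in \<open>auto simp: annih_def\<close>)
  moreover have "fst v + snd (snd (snd v)) = 0"
  proof (rule has_vector_derivative_kernel[OF _ _ assms(2)])
    show "bounded_linear (\<lambda>v::oct. fst v + snd (snd (snd v)))"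
      by (intro bounded_linear_add bounded_linear_fst bounded_linear_compose[OF bounded_linear_snd]
          bounded_linear_snd)
    show "fst (\<gamma> t) + snd (snd (snd (\<gamma> t))) = 0" for t
      using assms(1)[of t] by (auto simp: annih_def Im_oct_def)
  qed
  ultimately show ?thesis
    by (auto simp: annih_def Im_oct_def split: prod.splits)
qed

lemma subspace_annih: "subspace (annih \<zeta>)"
  unfolding subspace_def annih_def Im_oct_def
  by (auto simp: linear_0[OF linear_oct_mult] linear_add[OF linear_oct_mult]
      linear_scale[OF linear_oct_mult] linear_0[OF linear_oct_mult, unfolded zero_prod_def] zero_prod_def
      simp del: oct_mult.simps)

text \<open>The square of an imaginary element is minus its quadratic form times the unit
  \<open>(1, 0, 0, 1)\<close>.\<close>

lemma self_in_annih: "\<zeta> \<in> null_cone \<Longrightarrow> \<zeta> \<in> annih \<zeta>"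
  by (auto simp: null_cone_def annih_def Im_oct_def zero_prod_def inner_commute)

text \<open>A curve \<open>P t\<close> of projections onto lines in \<open>annih \<zeta>\<close> is lifted to \<open>annih \<zeta>\<close> near
  \<open>t = 0\<close> by \<open>P t \<zeta>\<close>.\<close>
lemma D_oct_eq:
  assumes "\<zeta> \<in> null_cone" "\<zeta> \<noteq> 0"
  shows "D_oct \<zeta> = dver \<zeta> ` annih \<zeta>"
proof (intro equalityI subsetI)
  fix P' assume "P' \<in> D_oct \<zeta>"
  then obtain P where P: "\<And>t. P t \<in> ver ` (annih \<zeta> - {0})" "P 0 = ver \<zeta>"
    and P': "(P has_vector_derivative P') (at 0)"
    unfolding D_oct_def using tangent_spaceE[of P'] by metis
  define w where "w t = blinfun_apply (P t) \<zeta>" for t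
  have w': "(w has_vector_derivative blinfun_apply P' \<zeta>) (at 0)"
    unfolding w_def using P'
    by (rule bounded_linear.has_vector_derivative[rotated])
      (rule blinfun.bounded_linear_left)
  have w0: "w 0 = \<zeta>" using assms(2) by (simp add: w_def P(2) ver_apply)
  have annih: "w t \<in> annih \<zeta>" for t
  proof -
    obtain u where "u \<in> annih \<zeta>" "P t = ver u" using P(1)[of t] by auto
    then show ?thesis using subspace_annih by (auto simp: w_def ver_apply subspace_scale)
  qed
  \<comment> \<open>A projection onto the line of \<open>u\<close> sends \<zeta> to a multiple of
    \<open>u\<close>; if that multiple is nonzero it spans the same line.\<close>
  have ver: "P t = ver (w t)" if "w t \<noteq> 0" for t
  proof -
    obtain u where u: "P t = ver u" using P(1)[of t] by auto
    then show ?thesis using that by (auto simp: w_def ver_apply ver_scaleR)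
  qed
  have "continuous (at 0) w"
    using w' has_vector_derivative_continuous by blast
  then have "\<forall>\<^sub>F t in at 0. w t \<noteq> 0"
    using assms(2) w0 by (metis isContD tendsto_imp_eventually_ne)
  then have ev: "\<forall>\<^sub>F t in at 0. ver (w t) = P t"
    by eventually_elim (simp add: ver)
  have "((\<lambda>t. ver (w t)) has_derivative (\<lambda>t. dver \<zeta> (t *\<^sub>R blinfun_apply P' \<zeta>))) (at 0)"
    using has_derivative_compose[OF w'[unfolded has_vector_derivative_def], of ver "dver \<zeta>"]
      has_derivative_ver[OF assms(2)] w0 by simp
  then have "(P has_derivative (\<lambda>t. dver \<zeta> (t *\<^sub>R blinfun_apply P' \<zeta>))) (at 0)"
    by (rule has_derivative_transform_eventually[OF _ ev]) (simp_all add: w0 P(2))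
  then have "(P has_vector_derivative dver \<zeta> (blinfun_apply P' \<zeta>)) (at 0)"
    by (simp add: has_vector_derivative_def linear_scale[OF bounded_linear.linear[OF bounded_linear_dver[OF assms(2)]]])
  then have "P' = dver \<zeta> (blinfun_apply P' \<zeta>)"
    using P' vector_derivative_unique_at by blast
  moreover have "blinfun_apply P' \<zeta> \<in> annih \<zeta>"
    by (rule annih_derivative[OF annih w'])
  ultimately show "P' \<in> dver \<zeta> ` annih \<zeta>" by blast
next
  fix P' assume "P' \<in> dver \<zeta> ` annih \<zeta>"
  then obtain \<eta> where \<eta>: "\<eta> \<in> annih \<zeta>" "P' = dver \<zeta> \<eta>" by blast
  \<comment> \<open>Dropping the radial component leaves the image under \<open>dver\<close>
    unchanged and keeps \<open>\<zeta> + t *\<^sub>R h\<close> away from 0 for every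
    \<open>t\<close>, as a curve defined on the whole real line is required.\<close>
  define h where "h = \<eta> - ((\<zeta> \<bullet> \<eta>) / (\<zeta> \<bullet> \<zeta>)) *\<^sub>R \<zeta>"
  have h: "h \<in> annih \<zeta>"
    unfolding h_def
    by (intro subspace_diff subspace_scale subspace_annih \<eta> self_in_annih assms)
  have orth: "\<zeta> \<bullet> h = 0"
    using assms(2) by (simp add: h_def inner_diff_right)
  have P': "P' = dver \<zeta> h"
    using dver_self[OF assms(2)] linear_diff[OF bounded_linear.linear[OF bounded_linear_dver[OF assms(2)]]]
      linear_scale[OF bounded_linear.linear[OF bounded_linear_dver[OF assms(2)]]]
    by (simp add: h_def \<eta>)
  have nz: "\<zeta> + t *\<^sub>R h \<noteq> 0" for t
  proof
    assume "\<zeta> + t *\<^sub>R h = 0"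
    then have "\<zeta> \<bullet> (\<zeta> + t *\<^sub>R h) = 0" by simp
    then show False using orth assms(2) by (simp add: inner_add_right)
  qed
  show "P' \<in> D_oct \<zeta>"
    unfolding D_oct_def
  proof (rule tangent_spaceI)
    show "smooth_on UNIV (\<lambda>t::real. ver (\<zeta> + t *\<^sub>R h))"
      unfolding ver_eq by (intro smooth_intros open_UNIV) (simp add: nz)
    show "ver (\<zeta> + t *\<^sub>R h) \<in> ver ` (annih \<zeta> - {0})" for t
      using nz[of t] h self_in_annih[OF assms(1)]
      by (auto intro!: imageI subspace_add subspace_scale subspace_annih)
    have "((\<lambda>t. \<zeta> + t *\<^sub>R h) has_derivative (\<lambda>t. t *\<^sub>R h)) (at 0)"
      by (auto intro!: derivative_eq_intros)
    from has_derivative_compose[OF this, of ver "dver \<zeta>"]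
    show "((\<lambda>t. ver (\<zeta> + t *\<^sub>R h)) has_vector_derivative P') (at 0)"
      by (simp add: has_vector_derivative_def P' has_derivative_ver[OF assms(2)]
           linear_scale[OF bounded_linear.linear[OF bounded_linear_dver[OF assms(2)]]])
  qed simp
qed

section \<open>The dancing pair model\<close>

lemma iota_lift_nonzero: "iota_lift p \<noteq> 0"
  by (simp add: iota_lift_def zero_prod_def)

lemma iota_lift_null_cone: "p \<in> Q_dan \<Longrightarrow> iota_lift p \<in> null_cone"
  by (auto simp: iota_lift_def Q_dan_def null_cone_def Im_oct_def)

lemma smooth_on_iota: "smooth_on UNIV iota"
proof -
  have "smooth_on UNIV iota_lift"
    unfolding iota_lift_def[abs_def] by (intro smooth_intros open_UNIV)
  moreover have "iota_lift p \<bullet> iota_lift p \<noteq> 0" for p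
    using iota_lift_nonzero by simp
  ultimately show ?thesis
    unfolding iota_def[abs_def] ver_eq by (intro smooth_intros open_UNIV) auto
qed

lemma has_derivative_iota:
  "(iota has_derivative (\<lambda>d. dver (iota_lift p) (0, fst d, snd d, 0))) (at p)"
proof -
  have "(iota_lift has_derivative (\<lambda>d. (0, fst d, snd d, 0))) (at p)"
    unfolding iota_lift_def[abs_def] by (auto intro!: derivative_eq_intros)
  from has_derivative_compose[OF this has_derivative_ver[OF iota_lift_nonzero]]
  show ?thesis by (simp add: iota_def[abs_def])
qed

lemma frechet_derivative_iota:
  "frechet_derivative iota (at p) = (\<lambda>d. dver (iota_lift p) (0, fst d, snd d, 0))"
  using frechet_derivative_at[OF has_derivative_iota] by simp

text \<open>The kernel of \<open>dver\<close> is the line of the lift, whose first coordinate is 1;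
  a vector on it with first coordinate 0 vanishes.\<close>

lemma inj_derivative_iota: "inj (\<lambda>d. dver (iota_lift p) (0, fst d, snd d, 0))"
proof -
  have "linear (\<lambda>d. dver (iota_lift p) (0, fst d, snd d, 0))"
    using has_derivative_iota has_derivative_linear by blast
  moreover have "d = 0" if "dver (iota_lift p) (0, fst d, snd d, 0) = 0" for d
    using dver_eq_0[OF iota_lift_nonzero that]
    by (auto simp: iota_lift_def prod_eq_iff)
  ultimately show ?thesis using linear_injective_0 by blast
qed

text \<open>The projection onto the line of \<open>iota_lift p\<close> sends the first basis vector
  to a nonzero multiple of the lift; scaling its first coordinate to 1 recovers
  \<open>p\<close>.\<close>

definition iota_inv :: "(oct \<Rightarrow>\<^sub>L oct) \<Rightarrow> (real^3) \<times> (real^3)" where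
  "iota_inv P = (let w = blinfun_apply P (1, 0, 0, 0) in
     (inverse (fst w) *\<^sub>R fst (snd w), inverse (fst w) *\<^sub>R fst (snd (snd w))))"

lemma iota_apply_nonzero: "fst (blinfun_apply (iota p) (1, 0, 0, 0)) \<noteq> 0"
proof -
  have "iota_lift p \<bullet> iota_lift p \<noteq> 0" using iota_lift_nonzero[of p] by simp
  moreover have "iota_lift p \<bullet> (1, 0, 0, 0) = 1" by (simp add: iota_lift_def)
  moreover have "fst (iota_lift p) = 1" by (simp add: iota_lift_def)
  ultimately show ?thesis
    unfolding iota_def ver_apply by simp
qed

lemma iota_inv_iota: "iota_inv (iota p) = p"
proof -
  have "iota_lift p \<bullet> iota_lift p \<noteq> 0" using iota_lift_nonzero[of p] by simp
  moreover have "iota_lift p \<bullet> (1, 0, 0, 0) = 1" by (simp add: iota_lift_def)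
  ultimately show ?thesis
    unfolding iota_inv_def iota_def ver_apply Let_def by (simp add: iota_lift_def)
qed

lemma smooth_embedding_iota: "smooth_embedding Q_dan iota"
proof -
  have cont: "continuous_on Q_dan iota"
    using has_derivative_continuous[OF has_derivative_iota]
    by (blast intro: continuous_at_imp_continuous_on)
  have contw: "continuous_on T (\<lambda>P::oct \<Rightarrow>\<^sub>L oct. blinfun_apply P (1, 0, 0, 0))" for T
    by (intro continuous_intros)
  have "homeomorphism Q_dan (iota ` Q_dan) iota iota_inv"
  proof (rule homeomorphismI[OF cont])
    show "continuous_on (iota ` Q_dan) iota_inv"
      unfolding iota_inv_def Let_def
      by (intro continuous_intros contw) (use iota_apply_nonzero in auto)
  qed (auto simp: iota_inv_iota)
  moreover have "inj_on iota Q_dan"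
    by (metis inj_onI iota_inv_iota)
  moreover have "smooth_ext Q_dan iota UNIV iota"
    by (simp add: smooth_extI_UNIV smooth_on_iota)
  moreover have "inj_on (frechet_derivative iota (at p)) (tangent_space Q_dan p)" for p
    unfolding frechet_derivative_iota by (rule inj_on_subset[OF inj_derivative_iota]) simp
  ultimately show ?thesis
    unfolding smooth_embedding_def by blast
qed

text \<open>Two components of the octonion product are the two equations on the right. Given these,
  the others follow from \<open>A \<bullet> (A \<times> dA) = 0\<close> and Lagrange's identity
  \<open>b \<times> (A \<times> dA) = - dA\<close>.\<close>

lemma annih_iota_lift:
  assumes "b \<bullet> A = 1"
  shows "(0, dA, db, 0) \<in> annih (iota_lift (A, b)) \<longleftrightarrow> b \<bullet> dA = 0 \<and> db = cross3 A dA"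
proof
  assume "(0, dA, db, 0) \<in> annih (iota_lift (A, b))"
  then show "b \<bullet> dA = 0 \<and> db = cross3 A dA"
    by (auto simp: annih_def iota_lift_def zero_prod_def)
next
  assume "b \<bullet> dA = 0 \<and> db = cross3 A dA"
  moreover from this have "cross3 b (cross3 A dA) = - dA"
    using assms by (simp add: Lagrange)
  ultimately show "(0, dA, db, 0) \<in> annih (iota_lift (A, b))"
    by (simp add: annih_def Im_oct_def iota_lift_def zero_prod_def inner_commute dot_cross_self)
qed

text \<open>Tangency comes for free: \<open>A \<times> dA\<close> is orthogonal to \<open>A\<close>
  and \<open>dA\<close>, so the straight line with this velocity stays inside
  \<open>Q_dan\<close>.\<close>

lemma D_dan_eq:
  assumes "b \<bullet> A = 1"
  shows "D_dan (A, b) = {(dA, db). b \<bullet> dA = 0 \<and> db = cross3 A dA}"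
proof -
  have "(dA, cross3 A dA) \<in> tangent_space Q_dan (A, b)" if "b \<bullet> dA = 0" for dA
  proof (rule tangent_spaceI)
    show "smooth_on UNIV (\<lambda>t. (A + t *\<^sub>R dA, b + t *\<^sub>R cross3 A dA))"
      by (intro smooth_intros open_UNIV)
    show "(A + t *\<^sub>R dA, b + t *\<^sub>R cross3 A dA) \<in> Q_dan" for t
      using assms that
      by (simp add: Q_dan_def inner_add_left inner_add_right dot_cross_self)
    show "((\<lambda>t. (A + t *\<^sub>R dA, b + t *\<^sub>R cross3 A dA)) has_vector_derivative (dA, cross3 A dA)) (at 0)"
      by (auto intro!: derivative_eq_intros simp: has_vector_derivative_def)
  qed simp
  then show ?thesis
    by (auto simp: D_dan_def inner_commute dot_cross_self)
qed

lemma differential_iota: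
  "differential_maps_onto Q_dan iota D_dan (\<lambda>p. D_oct (iota_lift p))"
proof -
  have "frechet_derivative iota (at p) ` D_dan p = D_oct (iota_lift p)" if p_in: "p \<in> Q_dan" for p
  proof -
    obtain A b where p: "p = (A, b)" and bA: "b \<bullet> A = 1"
      using p_in unfolding Q_dan_def by blast
    let ?\<zeta> = "iota_lift p"
    have null: "?\<zeta> \<in> null_cone" by (rule iota_lift_null_cone[OF p_in])
    note lin = bounded_linear.linear[OF bounded_linear_dver[OF iota_lift_nonzero[of p]]]
    have "dver ?\<zeta> \<eta> \<in> (\<lambda>d. dver ?\<zeta> (0, fst d, snd d, 0)) ` D_dan p" if \<eta>: "\<eta> \<in> annih ?\<zeta>" for \<eta>
    proof -
      \<comment> \<open>Subtracting this multiple of the lift makes the outer coordinates 0, and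
        \<open>dver\<close> does not see the change.\<close>
      let ?h = "\<eta> - fst \<eta> *\<^sub>R ?\<zeta>"
      have h: "?h \<in> annih ?\<zeta>"
        by (intro subspace_diff subspace_scale subspace_annih \<eta> self_in_annih null)
      obtain dA db where h_eq: "?h = (0, dA, db, 0)"
        using \<eta> by (cases \<eta>) (auto simp: annih_def Im_oct_def iota_lift_def)
      have "(dA, db) \<in> D_dan p"
        using h annih_iota_lift[OF bA] unfolding p h_eq[unfolded p] D_dan_eq[OF bA] by simp
      moreover have "dver ?\<zeta> \<eta> = dver ?\<zeta> (0, dA, db, 0)"
        using dver_self[OF iota_lift_nonzero[of p]]
        by (simp add: linear_diff[OF lin] linear_scale[OF lin] flip: h_eq)
      ultimately show ?thesis by force
    qed
    moreover have "(0, fst d, snd d, 0) \<in> annih ?\<zeta>" if "d \<in> D_dan p" for d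
      using that annih_iota_lift[OF bA] by (auto simp: p D_dan_eq[OF bA])
    ultimately show ?thesis
      unfolding frechet_derivative_iota D_oct_eq[OF null iota_lift_nonzero] by blast
  qed
  then show ?thesis
    unfolding differential_maps_onto_def
    using smooth_extI_UNIV[OF smooth_on_iota, of Q_dan iota] by blast
qed

section \<open>Quaternions and rolling\<close>

lemma qmult_assoc: "qmult (qmult a b) c = qmult a (qmult b c)"
  by (cases a; cases b; cases c) (simp add: cross3_simps forall_3)

lemma bounded_bilinear_qmult: "bounded_bilinear qmult"
proof -
  have "qmult = (\<lambda>p q. (fst p * fst q - snd p \<bullet> snd q,
      fst p *\<^sub>R snd q + fst q *\<^sub>R snd p + cross3 (snd p) (snd q)))"
    by (auto simp: fun_eq_iff)
  moreover have "bilinear \<dots>"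
    unfolding bilinear_def
    by (intro conjI allI linearI)
      (simp_all add: cross_add_left cross_add_right cross_mult_left cross_mult_right algebra_simps)
  ultimately show ?thesis by (simp add: bilinear_conv_bounded_bilinear)
qed

lemmas [smooth_intros] = smooth_on_bounded_bilinear[OF bounded_bilinear_qmult]

lemma bounded_linear_qconj: "bounded_linear qconj"
proof -
  have *: "qconj = (\<lambda>p. (fst p, - snd p))"
    by (auto simp: fun_eq_iff)
  show ?thesis
    unfolding * by (intro bounded_linear_Pair bounded_linear_fst bounded_linear_minus bounded_linear_snd)
qed

lemma qmult_real_left: "qmult (c, 0) q = c *\<^sub>R q"
  and qmult_real_right: "qmult q (c, 0) = c *\<^sub>R q"
  by (cases q; simp)+

lemma qconj_qmult: "qconj (qmult a b) = qmult (qconj b) (qconj a)"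
  by (cases a; cases b) (simp add: cross3_simps forall_3)

lemma qmult_qconj_left: "qmult (qconj q) q = (q \<bullet> q, 0)"
  and qmult_qconj_right: "qmult q (qconj q) = (q \<bullet> q, 0)"
  by (cases q; simp)+

lemma inner_qmult: "qmult a b \<bullet> qmult a b = (a \<bullet> a) * (b \<bullet> b)"
  by (cases a; cases b) (simp add: cross3_simps forall_3)

lemma inner_qmult_imaginary: "qmult (0, w) q \<bullet> q = 0"
  by (cases q) (simp add: cross3_simps)

text \<open>The real part of \<open>dq\<close> times the conjugate of \<open>q\<close> is
  \<open>dq \<bullet> q\<close>, and for unit \<open>q\<close> the conjugate is the inverse.\<close>

lemma imaginary_quotient:
  assumes "q \<bullet> q = 1" "dq \<bullet> q = 0"
  obtains w where "dq = qmult (0, w) q"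
proof
  have "qmult dq (qconj q) = (0, snd (qmult dq (qconj q)))"
    using assms(2) by (cases dq; cases q) simp
  moreover have "qmult (qmult dq (qconj q)) q = dq"
    using assms(1) by (simp add: qmult_assoc qmult_qconj_left qmult_real_right)
  ultimately show "dq = qmult (0, snd (qmult dq (qconj q))) q" by metis
qed

section \<open>Rotations by unit quaternions and their angular velocities\<close>

definition rotB :: "quat \<Rightarrow> quat \<Rightarrow> real^3^3" where
  "rotB p q = matrix (\<lambda>x. snd (qmult (qmult p (0, x)) (qconj q)))"

lemma rot_eq_rotB: "rot q = rotB q q"
  by (simp add: rot_def rotB_def)

lemma linear_sandwich: "linear (\<lambda>x. snd (qmult (qmult p (0, x)) q))"
proof -
  interpret qm: bounded_bilinear qmult by (rule bounded_bilinear_qmult)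
  have "linear (\<lambda>x. (0::real, x :: real^3))" by (rule linearI) auto
  moreover have "linear (\<lambda>x. snd (qmult (qmult p x) q))"
    by (rule linearI) (simp_all add: qm.add_left qm.add_right qm.scaleR_left qm.scaleR_right)
  ultimately show ?thesis
    using linear_compose[of "\<lambda>x. (0, x)" "\<lambda>x. snd (qmult (qmult p x) q)"] by (simp add: o_def)
qed

lemma rotB_apply: "rotB p q *v x = snd (qmult (qmult p (0, x)) (qconj q))"
  unfolding rotB_def by (rule fun_cong[OF matrix_vector_mul(2)[OF linear_sandwich]])

text \<open>Since \<open>rot\<close> is the diagonal of \<open>rotB\<close>, smoothness of the cover
  and its differential reduce to rules for bilinear maps.\<close>

lemma bounded_bilinear_rotB: "bounded_bilinear rotB"
proof -
  interpret qm: bounded_bilinear qmult by (rule bounded_bilinear_qmult)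
  note lin = bounded_linear.linear[OF bounded_linear_qconj]
  have eqI: "M = N" if "\<And>x. M *v x = N *v x" for M N :: "real^3^3"
    using that matrix_eq by blast
  have "bilinear rotB"
    unfolding bilinear_def
    by (intro conjI allI linearI)
      (auto intro!: eqI simp: rotB_apply matrix_vector_mult_add_rdistrib scaleR_matrix_vector_assoc[symmetric]
        qm.add_left qm.add_right qm.scaleR_left qm.scaleR_right linear_add[OF lin] linear_scale[OF lin]
        simp del: split_paired_All qmult.simps qconj.simps add_Pair scaleR_Pair)
  then show ?thesis by (simp add: bilinear_conv_bounded_bilinear)
qed

lemmas [smooth_intros] = smooth_on_bounded_bilinear[OF bounded_bilinear_rotB]

lemma rot_sandwich: "qmult (qmult q (0, x)) (qconj q) = (0, rot q *v x)"
proof -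
  have "fst (qmult (qmult q (0, x)) (qconj q)) = 0"
    by (cases q) (simp add: cross3_simps)
  then show ?thesis by (simp add: rot_eq_rotB rotB_apply prod_eq_iff)
qed

lemma rot_in_SO3:
  assumes "q \<bullet> q = 1"
  shows "rot q \<in> SO3"
proof -
  have conj: "qconj q \<bullet> qconj q = 1" using assms by (cases q) simp
  have "(rot q *v x) \<bullet> (rot q *v x) = x \<bullet> x" for x
    using inner_qmult[of "qmult q (0, x)" "qconj q"] inner_qmult[of q "(0, x)"] assms conj
    by (simp add: rot_sandwich)
  then have "orthogonal_transformation (\<lambda>x. rot q *v x)"
    unfolding orthogonal_transformation by (simp add: norm_eq_sqrt_inner)
  then have orth: "orthogonal_matrix (rot q)"
    by (simp add: orthogonal_transformation_matrix)
  \<comment> \<open>Conjugation by a unit quaternion is multiplicative and fixes the reals, and the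
    cross product is the imaginary part of a product of imaginary quaternions.\<close>
  have cross: "cross3 (rot q *v x) (rot q *v y) = rot q *v cross3 x y" for x y
  proof -
    interpret qm: bounded_bilinear qmult by (rule bounded_bilinear_qmult)
    have split: "qmult (0, x) (0, y) = (0, cross3 x y) - (x \<bullet> y) *\<^sub>R (1, 0)" by simp
    have "qmult (0, rot q *v x) (0, rot q *v y)
      = qmult (qmult q (0, x)) (qmult (qmult (qconj q) q) (qmult (0, y) (qconj q)))"
      by (simp add: qmult_assoc flip: rot_sandwich)
    also have "\<dots> = qmult (qmult q (qmult (0, x) (0, y))) (qconj q)"
      using assms by (simp add: qmult_qconj_left qmult_real_left qmult_assoc del: qmult.simps)
    also have "\<dots> = (0, rot q *v cross3 x y) - (x \<bullet> y) *\<^sub>R (1, 0)"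
      unfolding split qm.diff_left qm.diff_right qm.scaleR_left qm.scaleR_right
      by (simp add: rot_sandwich qmult_real_right qmult_qconj_right assms del: qmult.simps)
    finally show ?thesis by simp
  qed
  let ?e = "cross3 (axis 1 1) (axis 2 1)"
  \<comment> \<open>A general matrix \<open>M\<close> satisfies
    \<open>M^T (M x \<times> M y) = det M (x \<times> y)\<close>; compatibility with the cross
    product and orthogonality turn the left side into \<open>x \<times> y\<close>.\<close>
  have "det (rot q) *\<^sub>R ?e = transpose (rot q) *v (rot q *v ?e)"
    by (metis cross cross_matrix_mult)
  also have "\<dots> = ?e"
    using orth by (simp add: orthogonal_matrix matrix_vector_mul_assoc del: transpose_matrix_vector)
  finally have "det (rot q) = 1"
    by (simp add: cross_basis)
      (metis axis_eq_0_iff scaleR_cancel_right scaleR_one zero_neq_one)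
  with orth show ?thesis by (simp add: SO3_def)
qed

text \<open>The factor 2 is that of the commutator: \<open>w y - y w\<close> is twice the cross
  product for imaginary \<open>w\<close> and \<open>y\<close>.\<close>

lemma rotB_angular_velocity:
  assumes "q \<bullet> q = 1" "dq = qmult (0, w) q"
  shows "(rotB q dq + rotB dq q) *v x = cross3 (2 *\<^sub>R w) (rot q *v x)"
proof -
  have "qconj dq = qmult (qconj q) (0, - w)"
    by (simp add: assms(2) qconj_qmult)
  then have "qmult (qmult q (0, x)) (qconj dq) = qmult (0, rot q *v x) (0, - w)"
    by (simp add: qmult_assoc flip: rot_sandwich)
  moreover have "qmult (qmult dq (0, x)) (qconj q) = qmult (0, w) (0, rot q *v x)"
    by (simp add: qmult_assoc assms(2) flip: rot_sandwich)
  ultimately show ?thesis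
    by (simp add: rotB_apply matrix_vector_mult_add_rdistrib cross_mult_left cross_skew[of "rot q *v x"])
      (simp add: scaleR_2)
qed

lemma cross3_eqI:
  assumes "\<And>y. cross3 a y = cross3 b y"
  shows "a = b"
  using assms[of "axis 1 1"] assms[of "axis 2 1"]
  by (simp add: cross3_def axis_def vec_eq_iff forall_3)

text \<open>Clears the inverse in \<open>D_roll\<close> by substituting \<open>g *v x\<close> for
  \<open>x\<close>. As \<open>matrix_inv\<close> is defined by choice, orthogonality first has to
  supply a two-sided inverse.\<close>

lemma body_angular_velocity_iff:
  fixes g dg :: "real^3^3"
  assumes "orthogonal_matrix g"
  shows "(\<forall>x. (dg ** matrix_inv g) *v x = cross3 \<omega> x) \<longleftrightarrow> (\<forall>x. dg *v x = cross3 \<omega> (g *v x))"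
proof -
  have "\<exists>h. g ** h = mat 1 \<and> h ** g = mat 1"
    using assms by (auto simp: orthogonal_matrix_def)
  then have "g ** matrix_inv g = mat 1 \<and> matrix_inv g ** g = mat 1"
    unfolding matrix_inv_def by (rule someI_ex)
  then have "g *v (matrix_inv g *v x) = x" "matrix_inv g *v (g *v x) = x" for x
    by (simp_all add: matrix_vector_mul_assoc)
  then show ?thesis
    by (metis matrix_vector_mul_assoc)
qed

section \<open>The rolling distribution on the double cover\<close>

lemma has_derivative_cover_roll:
  "(cover_roll has_derivative (\<lambda>d. (fst d, rotB (snd p) (snd d) + rotB (snd d) (snd p)))) (at p)"
  unfolding cover_roll_def[abs_def] rot_eq_rotB
  using has_derivative_Pair[OF has_derivative_fst[OF has_derivative_ident]
      bounded_bilinear.FDERIV[OF bounded_bilinear_rotB has_derivative_snd[OF has_derivative_ident]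
        has_derivative_snd[OF has_derivative_ident]], of p UNIV] .

lemma frechet_derivative_cover_roll:
  "frechet_derivative cover_roll (at p) = (\<lambda>d. (fst d, rotB (snd p) (snd d) + rotB (snd d) (snd p)))"
  using frechet_derivative_at[OF has_derivative_cover_roll] by simp

lemma Qt_roll_iff: "(v, q) \<in> Qt_roll \<longleftrightarrow> v \<bullet> v = 1 \<and> q \<bullet> q = 1"
  unfolding Qt_roll_def S2_def S3_def mem_Times_iff mem_sphere_0 norm_eq_1 by simp

lemma tangent_space_Qt_roll:
  assumes "(v, q) \<in> Qt_roll"
  shows "tangent_space Qt_roll (v, q) = {(dv, dq). dv \<bullet> v = 0 \<and> dq \<bullet> q = 0}"
proof -
  have "dv \<bullet> v = 0 \<and> dq \<bullet> q = 0" if tan: "(dv, dq) \<in> tangent_space Qt_roll (v, q)" for dv dq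
  proof -
    obtain \<gamma> where \<gamma>: "\<And>t. \<gamma> t \<in> Qt_roll" "\<gamma> 0 = (v, q)"
      "(\<gamma> has_vector_derivative (dv, dq)) (at 0)"
      using tangent_spaceE[OF tan] by metis
    have "((\<lambda>t. fst (\<gamma> t)) has_vector_derivative dv) (at 0)"
      "((\<lambda>t. snd (\<gamma> t)) has_vector_derivative dq) (at 0)"
      using bounded_linear.has_vector_derivative[OF bounded_linear_fst \<gamma>(3)]
        bounded_linear.has_vector_derivative[OF bounded_linear_snd \<gamma>(3)] by simp_all
    moreover have "norm (fst (\<gamma> t)) = 1" "norm (snd (\<gamma> t)) = 1" for t
      using \<gamma>(1)[of t] by (auto simp: Qt_roll_def S2_def S3_def)
    ultimately show ?thesis
      using has_vector_derivative_sphere[of "\<lambda>t. fst (\<gamma> t)" dv 0]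
        has_vector_derivative_sphere[of "\<lambda>t. snd (\<gamma> t)" dq 0] \<gamma>(2) by simp
  qed
  moreover have "(dv, dq) \<in> tangent_space Qt_roll (v, q)" if "dv \<bullet> v = 0" "dq \<bullet> q = 0" for dv dq
  proof (rule tangent_spaceI)
    show "smooth_on UNIV (\<lambda>t. (circ v dv t, circ q dq t))"
      by (intro smooth_intros smooth_on_circ open_UNIV)
    show "(circ v dv t, circ q dq t) \<in> Qt_roll" for t
      using assms that by (auto simp: Qt_roll_def S2_def S3_def norm_circ)
    show "((\<lambda>t. (circ v dv t, circ q dq t)) has_vector_derivative (dv, dq)) (at 0)"
      by (intro has_vector_derivative_Pair circ_has_vector_derivative)
  qed simp
  ultimately show ?thesis by fast
qed

text \<open>Discharges the tangency condition in \<open>D_roll\<close>: the cover carries a curve in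
  \<open>Qt_roll\<close> to one in \<open>Q_roll\<close>.\<close>

lemma cover_roll_tangent:
  assumes "d \<in> tangent_space Qt_roll p"
  shows "frechet_derivative cover_roll (at p) d \<in> tangent_space Q_roll (cover_roll p)"
proof -
  obtain \<gamma> where \<gamma>: "smooth_on UNIV \<gamma>" "\<And>t. \<gamma> t \<in> Qt_roll" "\<gamma> 0 = p"
      "(\<gamma> has_vector_derivative d) (at 0)"
    using tangent_spaceE[OF assms] by metis
  have der: "(cover_roll has_derivative frechet_derivative cover_roll (at p)) (at p)"
    unfolding frechet_derivative_cover_roll by (rule has_derivative_cover_roll)
  show ?thesis
  proof (rule tangent_spaceI)
    show "smooth_on UNIV (\<lambda>t. cover_roll (\<gamma> t))"
      unfolding cover_roll_def rot_eq_rotB by (intro smooth_intros \<gamma>(1) open_UNIV)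
    show "cover_roll (\<gamma> t) \<in> Q_roll" for t
      using \<gamma>(2)[of t] rot_in_SO3[of "snd (\<gamma> t)"]
      by (auto simp: cover_roll_def Q_roll_def Qt_roll_def S3_def norm_eq_1)
    show "((\<lambda>t. cover_roll (\<gamma> t)) has_vector_derivative frechet_derivative cover_roll (at p) d) (at 0)"
      using has_derivative_compose[OF \<gamma>(4)[unfolded has_vector_derivative_def]
          der[folded \<gamma>(3)]] \<gamma>(3)
      by (simp add: has_vector_derivative_def linear_scale[OF has_derivative_linear[OF der]])
  qed (simp add: \<gamma>)
qed

lemma Dt_roll_eq:
  assumes "(v, q) \<in> Qt_roll"
  shows "Dt_roll (v, q) = {(dv, dq). dv \<bullet> v = 0 \<and> dq = qmult (0, 2 *\<^sub>R cross3 v dv) q}"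
proof -
  have v: "v \<bullet> v = 1" and q: "q \<bullet> q = 1" using assms by (simp_all add: Qt_roll_iff)
  have orth: "orthogonal_matrix (rot q)" using rot_in_SO3[OF q] by (simp add: SO3_def)
  have vel: "(\<forall>x. ((rotB q dq + rotB dq q) ** matrix_inv (rot q)) *v x = cross3 \<omega> x)
      \<longleftrightarrow> \<omega> = 2 *\<^sub>R w" if "dq = qmult (0, w) q" for dq w \<omega>
  proof -
    \<comment> \<open>Once \<open>rot q *v x\<close> ranges over all vectors, the cross products
      determine \<omega>.\<close>
    have surj: "\<exists>x. y = rot q *v x" for y
    proof
      show "y = rot q *v (transpose (rot q) *v y)"
        using orth by (simp add: orthogonal_matrix_def matrix_vector_mul_assoc del: transpose_matrix_vector)
    qed
    show ?thesis
      unfolding body_angular_velocity_iff[OF orth] rotB_angular_velocity[OF q that]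
      using surj cross3_eqI by metis
  qed
  have mem: "(dv, dq) \<in> Dt_roll (v, q) \<longleftrightarrow> dv \<bullet> v = 0 \<and> 4 *\<^sub>R dv = cross3 (2 *\<^sub>R w) v \<and> w \<bullet> v = 0"
    if "dq = qmult (0, w) q" for dv dq w
    using cover_roll_tangent[of "(dv, dq)" "(v, q)"] vel[OF that]
    by (auto simp: Dt_roll_def D_roll_def frechet_derivative_cover_roll cover_roll_def
      tangent_space_Qt_roll[OF assms] that inner_qmult_imaginary)
  \<comment> \<open>No slip fixes \<open>w\<close> only up to a multiple of \<open>v\<close>; no
    spin removes that freedom, and taking the cross product with \<open>v\<close> solves for
    \<open>w\<close>.\<close>
  have rolling: "4 *\<^sub>R dv = cross3 (2 *\<^sub>R w) v \<and> w \<bullet> v = 0 \<longleftrightarrow> w = 2 *\<^sub>R cross3 v dv"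
    if dv: "dv \<bullet> v = 0" for dv w
  proof
    assume w: "4 *\<^sub>R dv = cross3 (2 *\<^sub>R w) v \<and> w \<bullet> v = 0"
    then have "4 *\<^sub>R cross3 v dv = cross3 v (cross3 (2 *\<^sub>R w) v)"
      by (metis cross_mult_right)
    also have "\<dots> = 2 *\<^sub>R w"
      using w v by (simp add: Lagrange inner_commute)
    finally have "(1/2::real) *\<^sub>R (4 *\<^sub>R cross3 v dv) = (1/2::real) *\<^sub>R (2 *\<^sub>R w)" by simp
    then show "w = 2 *\<^sub>R cross3 v dv" by simp
  next
    assume w: "w = 2 *\<^sub>R cross3 v dv"
    have "cross3 (cross3 v dv) v = dv"
      using v dv by (simp add: cross_skew[of "cross3 v dv"] Lagrange inner_commute)
    then show "4 *\<^sub>R dv = cross3 (2 *\<^sub>R w) v \<and> w \<bullet> v = 0"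
      by (simp add: w cross_mult_left dot_cross_self inner_commute[of _ v])
  qed
  show ?thesis
  proof (intro equalityI subsetI; clarify)
    fix dv a b assume *: "(dv, a, b) \<in> Dt_roll (v, q)"
    then have "(a, b) \<bullet> q = 0"
      by (simp add: Dt_roll_def tangent_space_Qt_roll[OF assms])
    then obtain w where w: "(a, b) = qmult (0, w) q" using imaginary_quotient[OF q] by metis
    then show "dv \<bullet> v = 0 \<and> (a, b) = qmult (0, 2 *\<^sub>R cross3 v dv) q"
      using * mem[OF w] rolling by metis
  next
    fix dv a b assume "dv \<bullet> v = 0" "(a, b) = qmult (0, 2 *\<^sub>R cross3 v dv) q"
    then show "(dv, a, b) \<in> Dt_roll (v, q)"
      using mem rolling by metis
  qed
qed

section \<open>The map from the rolling space\<close>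

definition im_oct :: "(real^3) \<times> quat \<Rightarrow> oct" where
  "im_oct d = (fst (snd d), fst d + snd (snd d), fst d - snd (snd d), - fst (snd d))"

lemma bounded_linear_im_oct: "bounded_linear im_oct"
proof -
  have "linear im_oct"
    by (rule linearI) (simp_all add: im_oct_def algebra_simps)
  then show ?thesis by (simp add: linear_conv_bounded_linear)
qed

lemma im_oct_cases:
  assumes "\<zeta> \<in> Im_oct"
  obtains a r where "\<zeta> = im_oct (a, r)"
proof -
  obtain x A b where \<zeta>: "\<zeta> = (x, A, b, - x)"
    using assms by (auto simp: Im_oct_def)
  have "\<zeta> = im_oct ((1/2) *\<^sub>R (A + b), x, (1/2) *\<^sub>R (A - b))"
    by (simp add: im_oct_def \<zeta> vec_eq_iff field_simps)
  then show ?thesis by (rule that)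
qed

text \<open>Up to the factor \<open>sqrt 2\<close> the coordinates are isometric, so norms and
  orthogonality in the unit-vector model can be read off from pairs.\<close>

lemma inner_im_oct: "im_oct d \<bullet> im_oct e = 2 * (d \<bullet> e)"
  by (cases d; cases e) (simp add: im_oct_def inner_prod_def algebra_simps)

lemma im_oct_null_cone: "im_oct (v, r) \<in> null_cone \<longleftrightarrow> v \<bullet> v = r \<bullet> r"
  by (auto simp: im_oct_def null_cone_def Im_oct_def inner_prod_def algebra_simps inner_commute)

lemma Phi_lift_eq: "Phi_lift p = im_oct (fst p, qmult (0, fst p) (snd p))"
  by (simp add: Phi_lift_def im_oct_def Let_def)

lemma inner_Phi_lift:
  assumes "p \<in> Qt_roll"
  shows "Phi_lift p \<bullet> Phi_lift p = 4"
  using assms inner_qmult[of "(0, fst p)" "snd p"]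
  by (cases p) (simp add: Phi_lift_eq inner_im_oct Qt_roll_iff del: qmult.simps)

lemma Phi_lift_null_cone:
  assumes "p \<in> Qt_roll"
  shows "Phi_lift p \<in> null_cone - {0}"
proof -
  have "Phi_lift p \<noteq> 0"
    using inner_Phi_lift[OF assms] by auto
  moreover have "Phi_lift p \<in> null_cone"
    using assms inner_qmult[of "(0, fst p)" "snd p"]
    by (cases p) (simp add: Phi_lift_eq im_oct_null_cone Qt_roll_iff del: qmult.simps)
  ultimately show ?thesis by simp
qed

text \<open>The lift has constant norm 2 on \<open>Qt_roll\<close>, so the square root in
  \<open>sph\<close> disappears and a polynomial extends \<open>Phi\<close> to the whole
  space.\<close>

lemma Phi_eq:
  assumes "p \<in> Qt_roll"
  shows "Phi p = (1/2) *\<^sub>R Phi_lift p"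
proof -
  have "norm (Phi_lift p) = 2"
    using inner_Phi_lift[OF assms] by (simp add: norm_eq_sqrt_inner)
  then show ?thesis by (simp add: Phi_def sph_def)
qed

lemma has_derivative_Phi_lift:
  "(Phi_lift has_derivative (\<lambda>d. im_oct (fst d, qmult (0, fst p) (snd d) + qmult (0, fst d) (snd p)))) (at p)"
proof -
  have "((\<lambda>p::(real^3) \<times> quat. (0::real, fst p)) has_derivative (\<lambda>d. (0, fst d))) (at p)"
    by (auto intro!: derivative_eq_intros)
  from has_derivative_Pair[OF has_derivative_fst[OF has_derivative_ident]
      bounded_bilinear.FDERIV[OF bounded_bilinear_qmult this has_derivative_snd[OF has_derivative_ident]]]
  have "((\<lambda>p. (fst p, qmult (0, fst p) (snd p))) has_derivative
      (\<lambda>d. (fst d, qmult (0, fst p) (snd d) + qmult (0, fst d) (snd p)))) (at p)" .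
  from bounded_linear.has_derivative[OF bounded_linear_im_oct this] show ?thesis
    by (simp add: Phi_lift_eq[abs_def])
qed

lemma smooth_on_Phi_lift: "smooth_on UNIV Phi_lift"
  unfolding Phi_lift_def[abs_def] Let_def by (intro smooth_intros open_UNIV)

lemma smooth_ext_Phi: "smooth_ext Qt_roll Phi UNIV (\<lambda>p. (1/2) *\<^sub>R Phi_lift p)"
  by (intro smooth_extI_UNIV smooth_intros smooth_on_Phi_lift open_UNIV) (simp add: Phi_eq)

lemma Qt_oct_eq: "Qt_oct = {\<zeta> \<in> null_cone. norm \<zeta> = 1}"
proof (intro equalityI subsetI)
  fix \<zeta> assume "\<zeta> \<in> Qt_oct"
  then obtain w where w: "w \<in> null_cone" "w \<noteq> 0" "\<zeta> = (1 / norm w) *\<^sub>R w"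
    by (auto simp: Qt_oct_def sph_def)
  then have "\<zeta> \<in> null_cone"
    by (cases w) (auto simp: null_cone_def Im_oct_def field_simps)
  moreover have "norm \<zeta> = 1" using w by simp
  ultimately show "\<zeta> \<in> {\<zeta> \<in> null_cone. norm \<zeta> = 1}" by simp
next
  fix \<zeta> assume "\<zeta> \<in> {\<zeta> \<in> null_cone. norm \<zeta> = 1}"
  then have "\<zeta> \<in> null_cone - {0}" "\<zeta> = sph \<zeta>" by (auto simp: sph_def)
  then show "\<zeta> \<in> Qt_oct" unfolding Qt_oct_def by blast
qed

text \<open>On the unit vectors of the null cone, \<open>v = A + b\<close> and \<open>vq = (2x, A - b)\<close> are unit, so
  \<open>q = - v (vq)\<close>.\<close>
definition Phi_inv :: "oct \<Rightarrow> (real^3) \<times> quat" where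
  "Phi_inv \<zeta> = (let A = fst (snd \<zeta>); b = fst (snd (snd \<zeta>)) in
     (A + b, - qmult (0, A + b) (2 * fst \<zeta>, A - b)))"

lemma smooth_on_Phi_inv: "smooth_on UNIV Phi_inv"
  unfolding Phi_inv_def[abs_def] Let_def by (intro smooth_intros open_UNIV)

lemma Phi_inv_half_im_oct: "Phi_inv ((1/2) *\<^sub>R im_oct (v, r)) = (v, - qmult (0, v) r)"
proof -
  have "(1/2) *\<^sub>R (v + snd r) + (1/2) *\<^sub>R (v - snd r) = v"
    "(1/2) *\<^sub>R (v + snd r) - (1/2) *\<^sub>R (v - snd r) = snd r"
    by (simp_all add: vec_eq_iff field_simps)
  then show ?thesis
    unfolding Phi_inv_def Let_def im_oct_def by (simp del: qmult.simps)
qed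

text \<open>A unit imaginary quaternion squares to -1; both compositions of \<open>Phi\<close> and
  \<open>Phi_inv\<close> reduce to this.\<close>

lemma qmult_unit_imaginary:
  assumes "v \<bullet> v = 1"
  shows "qmult (0, v) (qmult (0, v) q) = - q"
proof -
  have "qmult (0, v) (0, v) = (-1, 0)" using assms by simp
  then show ?thesis
    by (metis qmult_assoc qmult_real_left scaleR_minus1_left)
qed

lemma Phi_inv_Phi:
  assumes "p \<in> Qt_roll"
  shows "Phi_inv (Phi p) = p"
  using assms
  by (cases p) (simp add: Phi_eq Phi_lift_eq Phi_inv_half_im_oct qmult_unit_imaginary Qt_roll_iff
      del: qmult.simps)

lemma Qt_oct_cases:
  assumes "\<zeta> \<in> Qt_oct"
  obtains v r where "\<zeta> = (1/2) *\<^sub>R im_oct (v, r)" "v \<bullet> v = 1" "r \<bullet> r = 1"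
proof -
  have \<zeta>: "\<zeta> \<in> null_cone" "\<zeta> \<bullet> \<zeta> = 1" using assms by (auto simp: Qt_oct_eq norm_eq_1)
  then obtain a s where as: "\<zeta> = im_oct (a, s)"
    using im_oct_cases unfolding null_cone_def by blast
  \<comment> \<open>Nullity makes the two lengths equal and the unit norm makes both 1/2, whence the
    rescaling by 2.\<close>
  have "a \<bullet> a = s \<bullet> s" "2 * (a \<bullet> a + s \<bullet> s) = 1"
    using \<zeta> unfolding as im_oct_null_cone inner_im_oct by auto
  then have "(2 *\<^sub>R a) \<bullet> (2 *\<^sub>R a) = 1" "(2 *\<^sub>R s) \<bullet> (2 *\<^sub>R s) = 1" by simp_all
  moreover have "\<zeta> = (1/2) *\<^sub>R im_oct (2 *\<^sub>R a, 2 *\<^sub>R s)"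
    unfolding as linear_scale[OF bounded_linear.linear[OF bounded_linear_im_oct], symmetric] by simp
  ultimately show ?thesis using that by blast
qed

lemma Phi_inv_Qt_oct:
  assumes "\<zeta> \<in> Qt_oct"
  shows "Phi_inv \<zeta> \<in> Qt_roll" "Phi (Phi_inv \<zeta>) = \<zeta>"
proof -
  obtain v r where \<zeta>: "\<zeta> = (1/2) *\<^sub>R im_oct (v, r)" and v: "v \<bullet> v = 1" and r: "r \<bullet> r = 1"
    using Qt_oct_cases[OF assms] .
  interpret qm: bounded_bilinear qmult by (rule bounded_bilinear_qmult)
  show mem: "Phi_inv \<zeta> \<in> Qt_roll"
    using inner_qmult[of "(0, v)" r] v r
    by (simp add: \<zeta> Phi_inv_half_im_oct Qt_roll_iff del: qmult.simps)
  show "Phi (Phi_inv \<zeta>) = \<zeta>"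
    unfolding Phi_eq[OF mem]
    by (simp add: \<zeta> Phi_inv_half_im_oct Phi_lift_eq qm.minus_right qmult_unit_imaginary[OF v]
       del: qmult.simps)
qed

lemma Phi_in_Qt_oct: "p \<in> Qt_roll \<Longrightarrow> Phi p \<in> Qt_oct"
  using Phi_lift_null_cone unfolding Phi_def Qt_oct_def by blast

lemma diffeomorphism_Phi: "diffeomorphism Qt_roll Qt_oct Phi"
  unfolding diffeomorphism_def
proof (intro conjI)
  show bij: "bij_betw Phi Qt_roll Qt_oct"
    by (rule bij_betw_byWitness[where f' = Phi_inv])
      (auto simp: Phi_inv_Phi Phi_inv_Qt_oct Phi_in_Qt_oct)
  show "smooth_map_on Qt_roll Phi"
    unfolding smooth_map_on_def using smooth_ext_Phi by blast
  have "Phi_inv \<zeta> = inv_into Qt_roll Phi \<zeta>" if "\<zeta> \<in> Qt_oct" for \<zeta>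
    using inv_into_f_eq[OF bij_betw_imp_inj_on[OF bij] Phi_inv_Qt_oct[OF that]] by simp
  then have "smooth_ext Qt_oct (inv_into Qt_roll Phi) UNIV Phi_inv"
    by (intro smooth_extI_UNIV smooth_on_Phi_inv)
  then show "smooth_map_on Qt_oct (inv_into Qt_roll Phi)"
    unfolding smooth_map_on_def by blast
qed

text \<open>The rays in the annihilator form the unit sphere of a linear subspace. The curve
  \<open>circ\<close> combines \<open>sph \<zeta>\<close> and \<eta> linearly, so it stays in that
  subspace.\<close>

lemma Dt_oct_eq:
  assumes "\<zeta> \<in> null_cone" "\<zeta> \<noteq> 0"
  shows "Dt_oct \<zeta> = {\<eta> \<in> annih \<zeta>. \<eta> \<bullet> \<zeta> = 0}"
proof -
  let ?S = "sph ` (annih \<zeta> - {0})"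
  have S: "?S = {\<eta> \<in> annih \<zeta>. norm \<eta> = 1}"
  proof (intro equalityI subsetI)
    fix \<eta> assume "\<eta> \<in> ?S"
    then obtain w where "w \<in> annih \<zeta>" "w \<noteq> 0" "\<eta> = (1 / norm w) *\<^sub>R w"
      by (auto simp: sph_def)
    then show "\<eta> \<in> {\<eta> \<in> annih \<zeta>. norm \<eta> = 1}"
      by (simp add: subspace_scale[OF subspace_annih])
  next
    fix \<eta> assume "\<eta> \<in> {\<eta> \<in> annih \<zeta>. norm \<eta> = 1}"
    then have "\<eta> \<in> annih \<zeta> - {0}" "\<eta> = sph \<eta>" by (auto simp: sph_def)
    then show "\<eta> \<in> ?S" by blast
  qed
  have self: "sph \<zeta> \<in> annih \<zeta>"
    unfolding sph_def by (intro subspace_scale subspace_annih self_in_annih assms)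
  have "\<eta> \<in> annih \<zeta> \<and> \<eta> \<bullet> \<zeta> = 0" if tan: "\<eta> \<in> Dt_oct \<zeta>" for \<eta>
  proof -
    obtain \<gamma> where \<gamma>: "\<And>t. \<gamma> t \<in> ?S" "\<gamma> 0 = sph \<zeta>" "(\<gamma> has_vector_derivative \<eta>) (at 0)"
      using tangent_spaceE[OF tan[unfolded Dt_oct_def]] by metis
    have "\<gamma> t \<in> annih \<zeta>" "norm (\<gamma> t) = 1" for t
      using \<gamma>(1)[of t] unfolding S by auto
    then have "\<eta> \<in> annih \<zeta>" "\<eta> \<bullet> \<gamma> 0 = 0"
      using annih_derivative[OF _ \<gamma>(3)] has_vector_derivative_sphere[OF _ \<gamma>(3)] by auto
    then show ?thesis using assms(2) by (simp add: \<gamma>(2) sph_def)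
  qed
  moreover have "\<eta> \<in> Dt_oct \<zeta>" if \<eta>: "\<eta> \<in> annih \<zeta>" "\<eta> \<bullet> \<zeta> = 0" for \<eta>
    unfolding Dt_oct_def
  proof (rule tangent_spaceI[OF smooth_on_circ])
    show "circ (sph \<zeta>) \<eta> t \<in> ?S" for t
    proof -
      have "circ (sph \<zeta>) \<eta> t \<in> annih \<zeta>"
        unfolding circ_def by (intro subspace_scale subspace_add subspace_annih self \<eta>)
      moreover have "norm (circ (sph \<zeta>) \<eta> t) = 1"
        by (rule norm_circ) (use assms(2) \<eta> in \<open>simp_all add: sph_def\<close>)
      ultimately show ?thesis unfolding S by simp
    qed
  qed (simp_all add: circ_has_vector_derivative)
  ultimately show ?thesis by fast
qed

text \<open>The two imaginary components of \<open>\<zeta>\<eta> = 0\<close> add up to the vector part of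
  \<open>s r\<^sup>-\<^sup>1 = a \<times> v\<close>.\<close>
lemma annih_im_oct_iff:
  assumes v: "v \<bullet> v = 1" and r: "r \<bullet> r = 1"
  shows "im_oct (a, s) \<in> annih (im_oct (v, r)) \<and> im_oct (a, s) \<bullet> im_oct (v, r) = 0 \<longleftrightarrow>
    a \<bullet> v = 0 \<and> s = qmult (0, cross3 a v) r"
proof
  assume L: "im_oct (a, s) \<in> annih (im_oct (v, r)) \<and> im_oct (a, s) \<bullet> im_oct (v, r) = 0"
  obtain x u where r_eq: "r = (x, u)" by (cases r)
  obtain x' u' where s_eq: "s = (x', u')" by (cases s)
  have "oct_mult (im_oct (v, r)) (im_oct (a, s)) = 0"
    using L by (simp add: annih_def)
  then have eqs: "x * x' - (a - u') \<bullet> (v + u) = 0"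
    "x *\<^sub>R (a + u') - x' *\<^sub>R (v + u) + cross3 (v - u) (a - u') = 0"
    "x' *\<^sub>R (v - u) - x *\<^sub>R (a - u') + cross3 (v + u) (a + u') = 0"
    "x * x' - (v - u) \<bullet> (a + u') = 0"
    by (simp_all add: im_oct_def r_eq s_eq zero_prod_def)
  have "a \<bullet> v + s \<bullet> r = 0" using L by (simp add: inner_im_oct)
  then have sum: "a \<bullet> v + (x' * x + u' \<bullet> u) = 0" by (simp add: r_eq s_eq)
  \<comment> \<open>The scalar equations add up to \<open>a \<bullet> v = s \<bullet> r\<close>,
    while orthogonality gives the opposite sign; hence both vanish.\<close>
  have av: "a \<bullet> v = 0" and rs: "x * x' + u \<bullet> u' = 0"
    using eqs(1,4) sum by (simp_all add: algebra_simps inner_commute)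
  have "2 *\<^sub>R (x *\<^sub>R u' - x' *\<^sub>R u - cross3 u' u) = 2 *\<^sub>R cross3 a v"
    using arg_cong2[OF eqs(2,3), of "(+)"]
    by (simp add: cross3_simps forall_3)
  then have vec: "x *\<^sub>R u' - x' *\<^sub>R u - cross3 u' u = cross3 a v" by simp
  have "qmult s (qconj r) = (0, cross3 a v)"
    using vec rs by (simp add: r_eq s_eq algebra_simps inner_commute)
  then have "qmult (0, cross3 a v) r = qmult s (qmult (qconj r) r)"
    by (simp add: qmult_assoc del: qmult.simps flip: qmult_assoc)
  then show "a \<bullet> v = 0 \<and> s = qmult (0, cross3 a v) r"
    using av r by (simp add: qmult_qconj_left qmult_real_right del: qmult.simps)
next
  assume R: "a \<bullet> v = 0 \<and> s = qmult (0, cross3 a v) r"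
  obtain x u where r_eq: "r = (x, u)" by (cases r)
  define c where "c = cross3 a v"
  have s_eq: "s = (- (c \<bullet> u), x *\<^sub>R c + cross3 c u)"
    using R by (simp add: r_eq c_def)
  have av: "a \<bullet> v = 0" "v \<bullet> a = 0" using R by (simp_all add: inner_commute)
  have cv: "c \<bullet> v = 0" "v \<bullet> c = 0" "c \<bullet> a = 0" "a \<bullet> c = 0"
    by (simp_all add: c_def dot_cross_self inner_commute)
  \<comment> \<open>Cross multiplication by the unit vector \<open>v\<close> is a quarter turn on
    the plane orthogonal to it.\<close>
  have vc: "cross3 v c = a" "cross3 v a = - c" "cross3 a v = c"
    using v av by (simp_all add: c_def Lagrange cross_skew[of v a])
  have xu: "x * x + u \<bullet> u = 1" using r by (simp add: r_eq)
  have "im_oct (a, s) \<bullet> im_oct (v, r) = 0"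
    using R inner_qmult_imaginary[of c r] by (simp add: inner_im_oct c_def)
  moreover have "oct_mult (im_oct (v, r)) (im_oct (a, s)) = 0"
  proof -
    \<comment> \<open>The imaginary part of \<open>s\<close>. Lagrange's identity expands its cross
      products in \<open>a\<close>, \<open>c\<close>, \<open>u\<close>, \<open>v\<close> and
      \<open>u \<times> c\<close>, after which the components cancel termwise.\<close>
    define u' where "u' = x *\<^sub>R c - cross3 u c"
    have s: "s = (- (c \<bullet> u), u')" by (simp add: s_eq u'_def cross_skew[of c u])
    have vu': "cross3 v u' = x *\<^sub>R a + (v \<bullet> u) *\<^sub>R c"
      by (simp add: u'_def Cross3.right_diff_distrib cross_mult_right vc Lagrange cv)
    have uu': "cross3 u u' = x *\<^sub>R cross3 u c - (u \<bullet> c) *\<^sub>R u + (u \<bullet> u) *\<^sub>R c"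
      by (simp add: u'_def Cross3.right_diff_distrib cross_mult_right Lagrange)
    have ua: "cross3 u a = (u \<bullet> c) *\<^sub>R v - (u \<bullet> v) *\<^sub>R c"
      by (simp add: Lagrange flip: vc(1))
    have "u' \<bullet> v = a \<bullet> u"
      using cross_triple[of v c u]
      by (simp add: u'_def inner_diff_right cv vc cross_skew[of c u] inner_commute[of _ v])
    moreover have "u' \<bullet> u = x * (c \<bullet> u)"
      by (simp add: u'_def inner_diff_left dot_cross_self)
    moreover have uuc: "(u \<bullet> u) *\<^sub>R c = c - (x * x) *\<^sub>R c"
      using xu by (simp add: algebra_simps flip: scaleR_left_distrib)
    ultimately show ?thesis
      by (simp add: im_oct_def r_eq s zero_prod_def Cross3.left_diff_distrib Cross3.right_diff_distrib
          cross_add_left cross_add_right vu' uu' ua vc av uuc inner_commute[of v u']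
          inner_commute[of u u'] inner_commute[of u c] inner_commute[of u a] inner_commute[of u v]
          inner_add_left inner_add_right inner_diff_left inner_diff_right)
        (simp add: u'_def algebra_simps)
  qed
  ultimately show "im_oct (a, s) \<in> annih (im_oct (v, r)) \<and> im_oct (a, s) \<bullet> im_oct (v, r) = 0"
    by (simp add: annih_def Im_oct_def im_oct_def)
qed

lemma differential_Phi:
  "differential_maps_onto Qt_roll Phi Dt_roll (\<lambda>p. Dt_oct (Phi_lift p))"
proof -
  interpret qm: bounded_bilinear qmult by (rule bounded_bilinear_qmult)
  let ?F = "\<lambda>p. (1/2) *\<^sub>R Phi_lift p"
  have "frechet_derivative ?F (at p) ` Dt_roll p = Dt_oct (Phi_lift p)" if p_in: "p \<in> Qt_roll" for p
  proof -
    obtain v q where p: "p = (v, q)" by (cases p)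
    have v: "v \<bullet> v = 1" and q: "q \<bullet> q = 1" using p_in by (simp_all add: p Qt_roll_iff)
    have r: "qmult (0, v) q \<bullet> qmult (0, v) q = 1"
      using inner_qmult[of "(0, v)" q] v q by (simp del: qmult.simps)
    \<comment> \<open>This is the pair \<open>(a, (a \<times> v) r)\<close> of the annihilator,
      rewritten with \<open>r = v q\<close> and \<open>(a \<times> v) v = - a\<close>.\<close>
    let ?D = "\<lambda>a. im_oct (a, - qmult (0, a) q)"
    have D_scale: "?D (c *\<^sub>R a) = c *\<^sub>R ?D a" for c a
    proof -
      have "(a', - qmult (0, a') q) = c *\<^sub>R (a, - qmult (0, a) q)" if "a' = c *\<^sub>R a" for a'
        using qm.scaleR_left[of c "(0, a)" q] that by (simp del: qmult.simps)
      then show ?thesis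
        using linear_scale[OF bounded_linear.linear[OF bounded_linear_im_oct]] by metis
    qed
    have "(?F has_derivative (\<lambda>d. (1/2) *\<^sub>R im_oct (fst d,
        qmult (0, v) (snd d) + qmult (0, fst d) q))) (at p)"
      using has_derivative_scaleR_right[OF has_derivative_Phi_lift[of p], of "1/2"]
      by (simp add: p del: qmult.simps)
    from frechet_derivative_at[OF this]
    have F': "frechet_derivative ?F (at p) = (\<lambda>d. (1/2) *\<^sub>R im_oct (fst d,
        qmult (0, v) (snd d) + qmult (0, fst d) q))" by (rule sym)
    have "frechet_derivative ?F (at p) (a, qmult (0, 2 *\<^sub>R cross3 v a) q) = (1/2) *\<^sub>R ?D a"
      if "a \<bullet> v = 0" for a
    proof -
      \<comment> \<open>For \<open>a\<close> orthogonal to the unit \<open>v\<close>,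
        \<open>v (v \<times> a) = - a\<close>. The product rule for \<open>v q\<close> then yields
        \<open>- 2 a q + a q = - a q\<close>.\<close>
      have "qmult (0, v) (0, 2 *\<^sub>R cross3 v a) = (-2) *\<^sub>R (0, a)"
        using v that
        by (simp add: dot_cross_self cross_mult_right Lagrange inner_commute)
      then have "qmult (0, v) (qmult (0, 2 *\<^sub>R cross3 v a) q) = (-2) *\<^sub>R qmult (0, a) q"
        by (metis qmult_assoc qm.scaleR_left)
      then have "qmult (0, v) (qmult (0, 2 *\<^sub>R cross3 v a) q) + qmult (0, a) q = - qmult (0, a) q"
        by (simp add: scaleR_2 del: qmult.simps)
      then show ?thesis unfolding F' by (simp del: qmult.simps)
    qed
    moreover have "Dt_roll p = (\<lambda>a. (a, qmult (0, 2 *\<^sub>R cross3 v a) q)) ` {a. a \<bullet> v = 0}"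
      unfolding p Dt_roll_eq[OF p_in[unfolded p]] by blast
    ultimately have "frechet_derivative ?F (at p) ` Dt_roll p = (\<lambda>a. (1/2) *\<^sub>R ?D a) ` {a. a \<bullet> v = 0}"
      unfolding image_image by (auto intro!: image_cong simp only: image_image mem_Collect_eq)
    \<comment> \<open>The normalising factor 1/2 is absorbed by rescaling \<open>a\<close> within a
      linear subspace.\<close>
    also have "\<dots> = ?D ` {a. a \<bullet> v = 0}"
    proof (intro equalityI subsetI)
      fix \<eta> assume "\<eta> \<in> (\<lambda>a. (1/2) *\<^sub>R ?D a) ` {a. a \<bullet> v = 0}"
      then obtain a where "a \<bullet> v = 0" "\<eta> = ?D ((1/2) *\<^sub>R a)" unfolding D_scale by blast
      then show "\<eta> \<in> ?D ` {a. a \<bullet> v = 0}"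
        by (intro image_eqI[of _ _ "(1/2) *\<^sub>R a"]) auto
    next
      fix \<eta> assume "\<eta> \<in> ?D ` {a. a \<bullet> v = 0}"
      then obtain a where a: "a \<bullet> v = 0" "\<eta> = ?D a" by blast
      then have "\<eta> = (1/2) *\<^sub>R ?D (2 *\<^sub>R a)" unfolding D_scale by simp
      then show "\<eta> \<in> (\<lambda>a. (1/2) *\<^sub>R ?D a) ` {a. a \<bullet> v = 0}"
        using a(1) by (intro image_eqI[of _ _ "2 *\<^sub>R a"]) auto
    qed
    also have "\<dots> = Dt_oct (Phi_lift p)"
    proof -
      have twist: "qmult (0, cross3 a v) (qmult (0, v) q) = - qmult (0, a) q" if "a \<bullet> v = 0" for a
      proof -
        have "cross3 (cross3 a v) v = - a"
          using v that by (simp add: cross_skew[of "cross3 a v"] Lagrange inner_commute)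
        then have "qmult (0, cross3 a v) (0, v) = - (0, a)"
          by (simp add: dot_cross_self)
        then show ?thesis by (metis qmult_assoc qm.minus_left)
      qed
      have "Phi_lift p \<in> null_cone" "Phi_lift p \<noteq> 0" using Phi_lift_null_cone[OF p_in] by auto
      then have Dt: "Dt_oct (Phi_lift p) = {\<eta> \<in> annih (Phi_lift p). \<eta> \<bullet> Phi_lift p = 0}"
        by (rule Dt_oct_eq)
      have lift: "Phi_lift p = im_oct (v, qmult (0, v) q)" by (simp add: Phi_lift_eq p)
      show ?thesis
        unfolding Dt unfolding lift
      proof (intro equalityI subsetI)
        fix \<eta> assume "\<eta> \<in> ?D ` {a. a \<bullet> v = 0}"
        then obtain a where a: "a \<bullet> v = 0" "\<eta> = ?D a" by blast
        then show "\<eta> \<in> {\<eta> \<in> annih (im_oct (v, qmult (0, v) q)). \<eta> \<bullet> im_oct (v, qmult (0, v) q) = 0}"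
          using annih_im_oct_iff[OF v r, of a "- qmult (0, a) q"] twist[of a]
          by (simp del: qmult.simps)
      next
        fix \<eta> assume \<eta>: "\<eta> \<in> {\<eta> \<in> annih (im_oct (v, qmult (0, v) q)). \<eta> \<bullet> im_oct (v, qmult (0, v) q) = 0}"
        then obtain a s where "\<eta> = im_oct (a, s)"
          using im_oct_cases unfolding annih_def by blast
        then show "\<eta> \<in> ?D ` {a. a \<bullet> v = 0}"
          using \<eta> annih_im_oct_iff[OF v r, of a s] twist[of a] by auto
      qed
    qed
    finally show ?thesis .
  qed
  then show ?thesis
    unfolding differential_maps_onto_def using smooth_ext_Phi by blast
qed

theorem theorem5:
  shows "iota ` Q_dan \<subseteq> Q_oct
    \<and> smooth_embedding Q_dan iota
    \<and> differential_maps_onto Q_dan iota D_dan (\<lambda>p. D_oct (iota_lift p))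
    \<and> (\<forall>p\<in>Qt_roll. Phi_lift p \<in> null_cone - {0})
    \<and> diffeomorphism Qt_roll Qt_oct Phi
    \<and> differential_maps_onto Qt_roll Phi Dt_roll (\<lambda>p. Dt_oct (Phi_lift p))"
proof -
  have "iota ` Q_dan \<subseteq> Q_oct"
    using iota_lift_null_cone iota_lift_nonzero unfolding iota_def Q_oct_def by blast
  then show ?thesis
    using smooth_embedding_iota differential_iota Phi_lift_null_cone diffeomorphism_Phi
      differential_Phi by blast
qed

end
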